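(* Let $\mathcal{O}$ be a Dedekind domain with field of fractions $K$ such that $1<|\mathrm{Cl}(\mathcal{O})|<\infty$, and let $n\ge 2$. Then $\mathrm{St}_n(K)$ is not generated by integral apartment classes.
   Context: $\mathrm{Cl}(\mathcal{O})$ is the ideal class group. The Tits building $\mathcal{T}_n(K)$ is the simplicial complex whose $p$-simplices are flags $0\subsetneq V_0\subsetneq\cdots\subsetneq V_p\subsetneq K^n$ of subspaces, and $\mathrm{St}_n(K)=\widetilde{H}_{n-2}(\mathcal{T}_n(K);\mathbb{Z})$. A frame of $K^n$ is a set $\mathcal{L}=\{L_1,\dots,L_n\}$ of lines with $K^n=L_1\oplus\cdots\oplus L_n$; its apartment $A_{\mathcal{L}}$ is the full subcomplex on the subspaces $\mathrm{span}(L_i:i\in I)$, $\emptyset\subsetneq I\subsetneq\{1,\dots,n\}$, homeomorphic to an $(n-2)$-sphere, with fundamental class $[A_{\mathcal{L}}]\in\mathrm{St}_n(K)$ (defined up to sign). The frame (and its apartment and apartment class) is integral if $\mathcal{O}^n=(L_1\cap\mathcal{O}^n)\oplus\cdots\oplus(L_n\cap\mathcal{O}^n)$. *)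

theory Defs
  imports
    "HOL-Analysis.Cartesian_Space"
    "HOL-Computational_Algebra.Polynomial"
    "HOL-Algebra.Algebraic_Closure_Type"
    "HOL-Algebra.Ideal_Product"
    "HOL-Algebra.Ring_Divisibility"
    "HOL-Algebra.Free_Abelian_Groups"
begin

section \<open>Dedekind domains and the ideal class group\<close>

text \<open>
  An integral domain is represented as a subring \<open>\<O>\<close> of an ambient field, the type \<open>'k\<close>.
  Its field of fractions is \<open>'k\<close> itself iff \<open>fractions \<O> = UNIV\<close>.
\<close>

definition subring_of_field :: "'k::field set \<Rightarrow> 'k ring" where
  "subring_of_field \<O> = ring_of_type_algebra\<lparr>carrier := \<O>\<rparr>"

definition fractions :: "'k::field set \<Rightarrow> 'k set" where
  "fractions \<O> = {a / b | a b. a \<in> \<O> \<and> b \<in> \<O> \<and> b \<noteq> 0}"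

definition integrally_closed :: "'k::field set \<Rightarrow> bool" where
  "integrally_closed \<O> \<longleftrightarrow>
     (\<forall>x \<in> fractions \<O>. \<forall>p. Polynomial.lead_coeff p = 1 \<and> (\<forall>i. Polynomial.coeff p i \<in> \<O>) \<and>
        Polynomial.poly p x = 0 \<longrightarrow> x \<in> \<O>)"

definition dedekind_domain :: "'k::field set \<Rightarrow> bool" where
  "dedekind_domain \<O> \<longleftrightarrow>
     subring \<O> ring_of_type_algebra \<and>
     noetherian_domain (subring_of_field \<O>) \<and>
     integrally_closed \<O> \<and>
     (\<forall>P. primeideal P (subring_of_field \<O>) \<and> P \<noteq> {0} \<longrightarrow> maximalideal P (subring_of_field \<O>))"

definition fractional_ideal :: "'k::field set \<Rightarrow> 'k set \<Rightarrow> bool" where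
  "fractional_ideal \<O> I \<longleftrightarrow>
     0 \<in> I \<and> (\<forall>x\<in>I. \<forall>y\<in>I. x + y \<in> I) \<and> (\<forall>a\<in>\<O>. \<forall>x\<in>I. a * x \<in> I) \<and>
     I \<noteq> {0} \<and> (\<exists>d\<in>\<O>. d \<noteq> 0 \<and> (\<forall>x\<in>I. d * x \<in> \<O>))"

definition fractional_ideal_group :: "'k::field set \<Rightarrow> 'k set monoid" where
  "fractional_ideal_group \<O> =
     \<lparr>carrier = Collect (fractional_ideal \<O>),
      monoid.mult = ideal_prod ring_of_type_algebra,
      one = \<O>\<rparr>"

definition principal_fractional_ideals :: "'k::field set \<Rightarrow> 'k set set" where
  "principal_fractional_ideals \<O> = {(\<lambda>a. x * a) ` \<O> | x. x \<noteq> 0 \<and> x \<in> fractions \<O>}"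

definition class_group :: "'k::field set \<Rightarrow> 'k set set monoid" where
  "class_group \<O> = fractional_ideal_group \<O> Mod principal_fractional_ideals \<O>"


section \<open>Reduced simplicial homology with integer coefficients\<close>

text \<open>
  A simplicial complex with compatibly ordered simplices is a set \<open>\<Delta>\<close> of lists (the simplices,
  with their vertices in order) that is closed under deleting entries; a \<open>p\<close>-simplex is a list of
  length \<open>p + 1\<close>.  The empty list is the \<open>(-1)\<close>-simplex, so that the boundary of a vertex is the
  augmentation and the homology below is reduced.
\<close>

definition simplicial_boundary :: "('v list \<Rightarrow>\<^sub>0 int) \<Rightarrow> ('v list \<Rightarrow>\<^sub>0 int)" where
  "simplicial_boundary =
     frag_extend (\<lambda>s. \<Sum>i<length s. frag_cmul ((-1) ^ i) (frag_of (take i s @ drop (Suc i) s)))"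

definition simplicial_chain_group :: "nat \<Rightarrow> 'v list set \<Rightarrow> ('v list \<Rightarrow>\<^sub>0 int) monoid" where
  "simplicial_chain_group p \<Delta> = free_Abelian_group {s \<in> \<Delta>. length s = Suc p}"

definition reduced_cycles :: "nat \<Rightarrow> 'v list set \<Rightarrow> ('v list \<Rightarrow>\<^sub>0 int) set" where
  "reduced_cycles p \<Delta> = {c \<in> carrier (simplicial_chain_group p \<Delta>). simplicial_boundary c = 0}"

definition simplicial_boundaries :: "nat \<Rightarrow> 'v list set \<Rightarrow> ('v list \<Rightarrow>\<^sub>0 int) set" where
  "simplicial_boundaries p \<Delta> = simplicial_boundary ` carrier (simplicial_chain_group (Suc p) \<Delta>)"

definition reduced_cycle_group :: "nat \<Rightarrow> 'v list set \<Rightarrow> ('v list \<Rightarrow>\<^sub>0 int) monoid" where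
  "reduced_cycle_group p \<Delta> = (simplicial_chain_group p \<Delta>)\<lparr>carrier := reduced_cycles p \<Delta>\<rparr>"

definition reduced_simplicial_homology :: "nat \<Rightarrow> 'v list set \<Rightarrow> ('v list \<Rightarrow>\<^sub>0 int) set monoid" where
  "reduced_simplicial_homology p \<Delta> = reduced_cycle_group p \<Delta> Mod simplicial_boundaries p \<Delta>"

definition simplicial_homology_class ::
    "nat \<Rightarrow> 'v list set \<Rightarrow> ('v list \<Rightarrow>\<^sub>0 int) \<Rightarrow> ('v list \<Rightarrow>\<^sub>0 int) set" where
  "simplicial_homology_class p \<Delta> c = simplicial_boundaries p \<Delta> #>\<^bsub>reduced_cycle_group p \<Delta>\<^esub> c"


section \<open>The Tits building and the Steinberg module\<close>

definition tits_building :: "('k::field ^ 'n) set list set" where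
  "tits_building =
     {s. sorted_wrt (\<subset>) s \<and> (\<forall>V \<in> set s. vec.subspace V \<and> V \<noteq> {0} \<and> V \<noteq> UNIV)}"

definition steinberg :: "(('k::field ^ 'n) set list \<Rightarrow>\<^sub>0 int) set monoid" where
  "steinberg = reduced_simplicial_homology (CARD('n) - 2) tits_building"


section \<open>Frames, apartments and integrality\<close>

text \<open>\<open>M\<close> is the internal direct sum of the subgroups \<open>F i\<close>, for \<open>i\<close> in the finite set \<open>I\<close>.\<close>

definition is_direct_sum :: "'m::comm_monoid_add set \<Rightarrow> 'i set \<Rightarrow> ('i \<Rightarrow> 'm set) \<Rightarrow> bool" where
  "is_direct_sum M I F \<longleftrightarrow> finite I \<and> bij_betw (\<lambda>f. \<Sum>i\<in>I. f i) (\<Pi>\<^sub>E i\<in>I. F i) M"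

definition frame :: "('k::field ^ 'n) set set \<Rightarrow> bool" where
  "frame \<L> \<longleftrightarrow>
     card \<L> = CARD('n) \<and> (\<forall>L\<in>\<L>. vec.subspace L \<and> vec.dim L = 1) \<and>
     is_direct_sum UNIV \<L> (\<lambda>L. L)"

definition lattice_of :: "'k::field set \<Rightarrow> ('k ^ 'n) set" where
  "lattice_of \<O> = {v. \<forall>i. v $ i \<in> \<O>}"

definition integral_frame :: "'k::field set \<Rightarrow> ('k ^ 'n) set set \<Rightarrow> bool" where
  "integral_frame \<O> \<L> \<longleftrightarrow>
     frame \<L> \<and> is_direct_sum (lattice_of \<O>) \<L> (\<lambda>L. L \<inter> lattice_of \<O>)"

definition apartment :: "('k::field ^ 'n) set set \<Rightarrow> ('k ^ 'n) set list set" where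
  "apartment \<L> =
     {s \<in> tits_building. set s \<subseteq> {vec.span (\<Union>S) | S. S \<noteq> {} \<and> S \<subset> \<L>}}"

text \<open>
  The apartment of a frame is a sphere of dimension \<open>n - 2\<close>, so its top reduced homology is
  infinite cyclic.  A fundamental class is a generator of that group, and an apartment class is
  its image in the Steinberg module under the inclusion of the apartment in the building.  Both
  choices of sign are included.
\<close>

definition fundamental_cycle :: "('k::field ^ 'n) set set \<Rightarrow> (('k ^ 'n) set list \<Rightarrow>\<^sub>0 int) \<Rightarrow> bool" where
  "fundamental_cycle \<L> z \<longleftrightarrow>
     z \<in> reduced_cycles (CARD('n) - 2) (apartment \<L>) \<and>
     generate (reduced_simplicial_homology (CARD('n) - 2) (apartment \<L>))
         {simplicial_homology_class (CARD('n) - 2) (apartment \<L>) z} =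
       carrier (reduced_simplicial_homology (CARD('n) - 2) (apartment \<L>))"

definition apartment_classes :: "('k::field ^ 'n) set set \<Rightarrow> (('k ^ 'n) set list \<Rightarrow>\<^sub>0 int) set set" where
  "apartment_classes \<L> =
     simplicial_homology_class (CARD('n) - 2) tits_building ` Collect (fundamental_cycle \<L>)"

definition integral_apartment_classes ::
    "'k::field set \<Rightarrow> (('k ^ 'n) set list \<Rightarrow>\<^sub>0 int) set set" where
  "integral_apartment_classes \<O> = (\<Union>\<L> \<in> Collect (integral_frame \<O>). apartment_classes \<L>)"

end

theory Submission
  imports Defs "HOL-Combinatorics.Permutations"
begin

text \<open>
  Write \<open>\<Lambda> = \<O>\<^sup>n\<close> and call a maximal flag \<open>0 = V\<^sub>0 \<subset> V\<^sub>1 \<subset> \<dots> \<subset> V\<^sub>n = K\<^sup>n\<close> cyclic if every quotient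
  \<open>(V\<^sub>j \<inter> \<Lambda>) / (V\<^sub>j\<^sub>-\<^sub>1 \<inter> \<Lambda>)\<close> is a cyclic \<open>\<O>\<close>-module. Since the building has dimension \<open>n - 2\<close>, the map
  \<open>\<phi>\<close> that adds up the coefficients of a cycle at the cyclic flags is a homomorphism on the Steinberg
  module. For an integral frame the quotients are the modules \<open>L\<^sub>i \<inter> \<Lambda>\<close> in some order, so either all
  flags of the apartment are cyclic or none is; as the sum of all coefficients of a cycle vanishes,
  \<open>\<phi>\<close> kills the integral apartment classes.

  On the other hand, if \<open>(\<O> : (a, b))\<close> is not principal, then in the apartment of the frame spanned by
  \<open>e\<^sub>1\<close> and \<open>a e\<^sub>j\<^sub>-\<^sub>1 + b e\<^sub>j\<close> for \<open>j \<ge> 2\<close> only the standard flag is cyclic, so \<open>\<phi>\<close> takes the value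
  \<open>1\<close> or \<open>-1\<close> on its class. Such \<open>a\<close> and \<open>b\<close> exist, since otherwise every ideal would be principal.
\<close>

section \<open>Colon ideals in Dedekind domains\<close>

lemma subring_of_field_simps [simp]:
  "carrier (subring_of_field \<O>) = \<O>"
  "x \<otimes>\<^bsub>subring_of_field \<O>\<^esub> y = x * y"
  "x \<oplus>\<^bsub>subring_of_field \<O>\<^esub> y = x + y"
  "\<zero>\<^bsub>subring_of_field \<O>\<^esub> = 0"
  "\<one>\<^bsub>subring_of_field \<O>\<^esub> = 1"
  by (simp_all add: subring_of_field_def ring_of_type_algebra_def)

text \<open>Zorn's lemma applies because in a noetherian ring the union of a chain of ideals belongs
  to the chain.\<close>

lemma noetherian_maximal_ideal:
  assumes "noetherian_ring R" "\<S> \<noteq> {}" "\<And>J. J \<in> \<S> \<Longrightarrow> ideal J R"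
  shows "\<exists>J\<in>\<S>. \<forall>J'\<in>\<S>. J \<subseteq> J' \<longrightarrow> J' = J"
proof (rule subset_Zorn_nonempty[OF assms(2)])
  fix C assume C: "C \<noteq> {}" "subset.chain \<S> C"
  then have "subset.chain {I. ideal I R} C"
    using assms(3) by (auto simp: subset_chain_def)
  then have "\<Union>C \<in> C"
    using noetherian_ring.ideal_chain_is_trivial[OF assms(1)] C(1) by blast
  then show "\<Union>C \<in> \<S>"
    using C(2) by (auto simp: subset_chain_def)
qed

locale dedekind =
  fixes \<O> :: "'k::field set"
  assumes dedekind: "dedekind_domain \<O>"
begin

abbreviation "R \<equiv> subring_of_field \<O>"

lemma noetherian: "noetherian_ring R" and domain: "domain R"
  using dedekind by (auto simp: dedekind_domain_def noetherian_domain_def)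

lemma cring: "cring R" and ring: "ring R"
  using domain by (auto simp: domain_def cring_def)

lemma zero_mem: "0 \<in> \<O>" and one_mem: "1 \<in> \<O>"
  and add_mem: "x \<in> \<O> \<Longrightarrow> y \<in> \<O> \<Longrightarrow> x + y \<in> \<O>"
  and mult_mem: "x \<in> \<O> \<Longrightarrow> y \<in> \<O> \<Longrightarrow> x * y \<in> \<O>"
proof -
  interpret ring R by (rule ring)
  show "0 \<in> \<O>" "1 \<in> \<O>" "x \<in> \<O> \<Longrightarrow> y \<in> \<O> \<Longrightarrow> x + y \<in> \<O>" "x \<in> \<O> \<Longrightarrow> y \<in> \<O> \<Longrightarrow> x * y \<in> \<O>"
    using zero_closed one_closed add.m_closed[of x y] m_closed[of x y] by simp_all
qed

lemma uminus_mem: "x \<in> \<O> \<Longrightarrow> - x \<in> \<O>"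
proof -
  interpret ring R by (rule ring)
  assume x: "x \<in> \<O>"
  then obtain y where "y \<in> \<O>" "x + y = 0"
    using add.r_inv_ex[of x] by auto
  then show ?thesis
    by (metis add.inverse_unique)
qed

text \<open>Restates ideals with the operations of the field. Closure under negation comes from
  multiplication by \<open>- 1\<close>.\<close>

lemma ideal_iff:
  "ideal J R \<longleftrightarrow> J \<subseteq> \<O> \<and> 0 \<in> J \<and> (\<forall>x\<in>J. \<forall>y\<in>J. x + y \<in> J) \<and> (\<forall>a\<in>\<O>. \<forall>x\<in>J. a * x \<in> J)"
proof
  assume "ideal J R"
  then interpret ideal J R .
  show "J \<subseteq> \<O> \<and> 0 \<in> J \<and> (\<forall>x\<in>J. \<forall>y\<in>J. x + y \<in> J) \<and> (\<forall>a\<in>\<O>. \<forall>x\<in>J. a * x \<in> J)"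
    using a_subset additive_subgroup.zero_closed[OF is_additive_subgroup]
      additive_subgroup.a_closed[OF is_additive_subgroup] I_l_closed by auto
next
  assume J: "J \<subseteq> \<O> \<and> 0 \<in> J \<and> (\<forall>x\<in>J. \<forall>y\<in>J. x + y \<in> J) \<and> (\<forall>a\<in>\<O>. \<forall>x\<in>J. a * x \<in> J)"
  interpret ring R by (rule ring)
  have neg: "- x \<in> J" if "x \<in> J" for x
    using J that uminus_mem[OF one_mem] by (metis mult_minus1)
  have "subgroup J (add_monoid R)"
  proof (rule add.subgroupI)
    fix x assume x: "x \<in> J"
    then have "\<ominus>\<^bsub>R\<^esub> x = - x"
      using J neg[OF x] by (intro minus_equality) auto
    then show "\<ominus>\<^bsub>R\<^esub> x \<in> J"
      using neg[OF x] by simp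
  qed (use J in auto)
  then show "ideal J R"
    using J by (intro idealI ring) (simp, simp, metis mult.commute subring_of_field_simps(1,2))
qed

text \<open>
  Among the ideals \<open>(c : y)\<close> contained in \<open>M\<close> a maximal one is prime, hence equal to \<open>M\<close>, and
  then \<open>x = y / c\<close> satisfies \<open>x M \<subseteq> \<O>\<close>.
\<close>

lemma maximal_ideal_colon_nontrivial:
  assumes M: "maximalideal M R" and c: "c \<in> M" "c \<noteq> 0"
  shows "\<exists>x. x \<notin> \<O> \<and> (\<forall>m\<in>M. x * m \<in> \<O>)"
proof -
  interpret cring R by (rule cring)
  interpret M: maximalideal M R by (rule M)
  interpret P: primeideal M R by (rule maximalideal_prime[OF M])
  \<comment> \<open>\<open>Q y\<close> is the ideal (c : y). If \<open>J = Q y\<close>, then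
    \<open>Q (e * y)\<close> is (J : e), which is the content of \<open>mult_Q\<close>.\<close>
  define Q where "Q y = {d \<in> \<O>. d * y \<in> (*) c ` \<O>}" for y
  have idQ: "ideal (Q y) R" for y
    unfolding ideal_iff
  proof (intro conjI ballI)
    show "Q y \<subseteq> \<O>" "0 \<in> Q y"
      using zero_mem by (auto simp: Q_def intro: image_eqI[of _ _ 0])
  next
    fix u v assume "u \<in> Q y" "v \<in> Q y"
    then obtain u' v' where "u \<in> \<O>" "v \<in> \<O>" "u' \<in> \<O>" "v' \<in> \<O>" "u * y = c * u'" "v * y = c * v'"
      by (auto simp: Q_def)
    then show "u + v \<in> Q y"
      by (auto simp: Q_def add_mem distrib_right distrib_left intro!: image_eqI[of _ _ "u' + v'"])
  next
    fix u v assume "u \<in> \<O>" "v \<in> Q y"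
    then obtain v' where "u \<in> \<O>" "v \<in> \<O>" "v' \<in> \<O>" "v * y = c * v'"
      by (auto simp: Q_def)
    then show "u * v \<in> Q y"
      by (auto simp: Q_def mult_mem mult.assoc intro!: image_eqI[of _ _ "u * v'"])
  qed
  define \<S> where "\<S> = {Q y | y. y \<in> \<O> \<and> Q y \<subseteq> M}"
  have "Q 1 \<subseteq> M"
  proof
    fix d assume "d \<in> Q 1"
    then obtain e where "e \<in> \<O>" "d = e * c"
      by (auto simp: Q_def mult.commute)
    then show "d \<in> M"
      using M.I_l_closed[OF c(1)] by auto
  qed
  then have "\<S> \<noteq> {}"
    unfolding \<S>_def using one_mem by blast
  moreover have "\<And>J. J \<in> \<S> \<Longrightarrow> ideal J R"
    using idQ by (auto simp: \<S>_def)
  ultimately obtain J where "J \<in> \<S>" and Jmax: "\<And>J'. J' \<in> \<S> \<Longrightarrow> J \<subseteq> J' \<Longrightarrow> J' = J"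
    using noetherian_maximal_ideal[OF noetherian, of \<S>] by blast
  then obtain y where y: "y \<in> \<O>" "J = Q y" and JM: "J \<subseteq> M"
    by (auto simp: \<S>_def)
  have MO: "M \<subseteq> \<O>" and M1: "1 \<notin> M"
    using M.a_subset M.I_notcarr M.one_imp_carrier by auto
  have mult_Q: "d \<in> Q (e * y) \<longleftrightarrow> d * e \<in> J" if "d \<in> \<O>" "e \<in> \<O>" for d e
    using that by (auto simp: Q_def y mult_mem mult.assoc)
  \<comment> \<open>The ideal \<open>Q (e * y)\<close> contains \<open>J\<close> and also
    \<open>d\<close>, so it is strictly larger. By maximality of \<open>J\<close> it is not
    contained in \<open>M\<close>, and any of its elements outside \<open>M\<close> serves as
    \<open>s\<close>.\<close>
  have escape: "\<exists>s\<in>\<O>. s \<notin> M \<and> s * e \<in> J" if e: "e \<in> \<O>" "d \<in> \<O>" "d \<notin> J" "d * e \<in> J" for d e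
  proof (rule ccontr)
    assume no: "\<not> ?thesis"
    have "Q (e * y) \<subseteq> M"
    proof
      fix s assume s: "s \<in> Q (e * y)"
      then have "s \<in> \<O>" by (auto simp: Q_def)
      with s no e mult_Q show "s \<in> M" by blast
    qed
    then have "Q (e * y) \<in> \<S>"
      using y e mult_mem by (auto simp: \<S>_def)
    moreover have "J \<subseteq> Q (e * y)"
    proof
      fix s assume s: "s \<in> J"
      then have "s \<in> \<O>" "e * s \<in> J"
        using JM MO idQ[of y] e y by (auto simp: ideal_iff)
      then show "s \<in> Q (e * y)"
        using mult_Q e by (simp add: mult.commute)
    qed
    ultimately have "Q (e * y) = J"
      by (rule Jmax)
    then show False
      using e mult_Q by blast
  qed
  have "primeideal J R"
  proof (rule primeidealI)
    show "ideal J R" using idQ y by simp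
    show "carrier R \<noteq> J" using JM M1 one_mem by auto
    fix d e assume "d \<in> carrier R" "e \<in> carrier R" "d \<otimes>\<^bsub>R\<^esub> e \<in> J"
    then have de: "d \<in> \<O>" "e \<in> \<O>" "d * e \<in> J" by auto
    show "d \<in> J \<or> e \<in> J"
    proof (rule ccontr)
      assume "\<not> (d \<in> J \<or> e \<in> J)"
      then have n: "d \<notin> J" "e \<notin> J" by auto
      \<comment> \<open>\<open>escape\<close> is applied to \<open>d\<close>, \<open>e\<close> and
        then to \<open>e\<close>, \<open>s\<close>. The resulting product \<open>t * s\<close> lies
        in \<open>J\<close>, hence in the prime ideal \<open>M\<close>, although neither factor
        does.\<close>
      obtain s where s: "s \<in> \<O>" "s \<notin> M" "s * e \<in> J"
        using escape[OF de(2,1) n(1) de(3)] by auto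
      obtain t where t: "t \<in> \<O>" "t \<notin> M" "t * s \<in> J"
        using escape[OF s(1) de(2) n(2)] s by (auto simp: mult.commute)
      then show False
        using P.I_prime[of t s] s JM by auto
    qed
  qed (rule cring)
  \<comment> \<open>So \<open>J\<close> is nonzero, and nonzero primes are maximal by the dimension
    condition.\<close>
  moreover have "c \<in> J"
    using c MO y by (auto simp: Q_def)
  ultimately have "maximalideal J R"
    using dedekind c by (auto simp: dedekind_domain_def)
  then interpret J: maximalideal J R .
  have "M = J"
    using J.I_maximal[of M] M.is_ideal JM MO M1 one_mem by auto
  show ?thesis
  proof (intro exI conjI ballI)
    show "y / c \<notin> \<O>"
    proof
      assume "y / c \<in> \<O>"
      then have "1 \<in> J"
        using c one_mem by (auto simp: y Q_def intro!: image_eqI[of _ _ "y / c"])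
      with JM M1 show False by auto
    qed
    fix m assume "m \<in> M"
    then obtain e where "e \<in> \<O>" "m * y = c * e"
      using \<open>M = J\<close> by (auto simp: y Q_def)
    then show "y / c * m \<in> \<O>"
      using c by (simp add: mult.commute)
  qed
qed

section \<open>Ideals with two generators and their inverses \<open>colon a b\<close> in the
  field\<close>

definition colon :: "'k \<Rightarrow> 'k \<Rightarrow> 'k set" where
  "colon a b = {x. x * a \<in> \<O> \<and> x * b \<in> \<O>}"

definition ideal2 :: "'k \<Rightarrow> 'k \<Rightarrow> 'k set" where
  "ideal2 a b = {x * a + y * b | x y. x \<in> \<O> \<and> y \<in> \<O>}"

lemma ideal2:
  assumes "a \<in> \<O>" "b \<in> \<O>"
  shows "ideal (ideal2 a b) R" "a \<in> ideal2 a b" "b \<in> ideal2 a b"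
proof -
  show "a \<in> ideal2 a b" "b \<in> ideal2 a b"
    unfolding ideal2_def using zero_mem one_mem
    by (metis (mono_tags, lifting) add.right_neutral add_0 mem_Collect_eq mult_1 mult_zero_left)+
  show "ideal (ideal2 a b) R"
    unfolding ideal_iff
  proof (intro conjI ballI)
    show "ideal2 a b \<subseteq> \<O>"
      using assms by (auto simp: ideal2_def add_mem mult_mem)
    show "0 \<in> ideal2 a b"
      unfolding ideal2_def using zero_mem by force
  next
    fix u v assume "u \<in> ideal2 a b" "v \<in> ideal2 a b"
    then obtain x y x' y' where "x \<in> \<O>" "y \<in> \<O>" "x' \<in> \<O>" "y' \<in> \<O>" "u = x * a + y * b" "v = x' * a + y' * b"
      by (auto simp: ideal2_def)
    then have "u + v = (x + x') * a + (y + y') * b" "x + x' \<in> \<O>" "y + y' \<in> \<O>"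
      by (auto simp: algebra_simps add_mem)
    then show "u + v \<in> ideal2 a b"
      unfolding ideal2_def by blast
  next
    fix u v assume "u \<in> \<O>" "v \<in> ideal2 a b"
    then obtain x y where "x \<in> \<O>" "y \<in> \<O>" "v = x * a + y * b" "u \<in> \<O>"
      by (auto simp: ideal2_def)
    then have "u * v = (u * x) * a + (u * y) * b" "u * x \<in> \<O>" "u * y \<in> \<O>"
      by (auto simp: algebra_simps mult_mem)
    then show "u * v \<in> ideal2 a b"
      unfolding ideal2_def by blast
  qed
qed

text \<open>If (a, b) were proper, it would lie in a maximal ideal \<open>M\<close>. An
  \<open>x\<close> outside \<O> that multiplies \<open>M\<close> into \<O> would then belong to
  \<open>colon a b\<close>.\<close>

lemma one_mem_ideal2:
  assumes "a \<in> \<O>" "b \<in> \<O>" "a \<noteq> 0" "colon a b \<subseteq> \<O>"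
  shows "1 \<in> ideal2 a b"
proof (rule ccontr)
  assume n1: "1 \<notin> ideal2 a b"
  define \<S> where "\<S> = {J. ideal J R \<and> ideal2 a b \<subseteq> J \<and> 1 \<notin> J}"
  have "\<S> \<noteq> {}"
    using ideal2(1)[OF assms(1,2)] n1 by (auto simp: \<S>_def)
  moreover have "\<And>J. J \<in> \<S> \<Longrightarrow> ideal J R"
    by (auto simp: \<S>_def)
  ultimately obtain M where M: "M \<in> \<S>" and Mmax: "\<And>J. J \<in> \<S> \<Longrightarrow> M \<subseteq> J \<Longrightarrow> J = M"
    using noetherian_maximal_ideal[OF noetherian, of \<S>] by blast
  have "maximalideal M R"
  proof (rule maximalidealI)
    show "ideal M R" "carrier R \<noteq> M"
      using M one_mem by (auto simp: \<S>_def)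
    fix J assume J: "ideal J R" "M \<subseteq> J" "J \<subseteq> carrier R"
    show "J = M \<or> J = carrier R"
    proof (cases "1 \<in> J")
      case True
      then show ?thesis
        using ideal.one_imp_carrier[OF J(1)] by simp
    next
      case False
      then have "J \<in> \<S>"
        using J M by (auto simp: \<S>_def)
      then show ?thesis
        using Mmax J(2) by blast
    qed
  qed
  moreover have abM: "a \<in> M" "b \<in> M"
    using M ideal2(2,3)[OF assms(1,2)] by (auto simp: \<S>_def)
  ultimately obtain x where "x \<notin> \<O>" "\<And>m. m \<in> M \<Longrightarrow> x * m \<in> \<O>"
    using maximal_ideal_colon_nontrivial assms(3) by blast
  then show False
    using abM assms(4) by (auto simp: colon_def)
qed

text \<open>After scaling \<open>a\<close> and \<open>b\<close> by the generator \<open>x\<close>,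
  the colon ideal lies in \<O>, so \<open>x * a\<close> and \<open>x * b\<close> generate the unit
  ideal. Dividing by \<open>x\<close> shows that \<open>inverse x\<close> generates (a, b); it is
  the witness for \<open>z\<close>.\<close>

lemma ideal2_principal:
  assumes ab: "a \<in> \<O>" "b \<in> \<O>" "a \<noteq> 0" and x: "colon a b = (*) x ` \<O>"
  shows "\<exists>z\<in>ideal2 a b. \<exists>s\<in>\<O>. \<exists>t\<in>\<O>. a = s * z \<and> b = t * z"
proof -
  have "x \<in> colon a b"
    unfolding x using one_mem by (auto intro: image_eqI[of _ _ 1])
  then have xab: "x * a \<in> \<O>" "x * b \<in> \<O>"
    by (auto simp: colon_def)
  have "1 \<in> colon a b"
    using ab by (auto simp: colon_def)
  then have x0: "x \<noteq> 0"
    unfolding x by auto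
  have "colon (x * a) (x * b) \<subseteq> \<O>"
  proof
    fix y assume "y \<in> colon (x * a) (x * b)"
    then have "x * y \<in> colon a b"
      by (auto simp: colon_def ac_simps)
    then show "y \<in> \<O>"
      unfolding x using x0 by auto
  qed
  then have "1 \<in> ideal2 (x * a) (x * b)"
    using xab ab x0 by (intro one_mem_ideal2) auto
  then obtain s t where st: "s \<in> \<O>" "t \<in> \<O>" "1 = s * (x * a) + t * (x * b)"
    by (auto simp: ideal2_def)
  have "inverse x = inverse x * (s * (x * a) + t * (x * b))"
    by (simp flip: st(3))
  also have "\<dots> = s * a + t * b"
    using x0 by (simp add: field_simps)
  finally have "inverse x \<in> ideal2 a b"
    using st by (auto simp: ideal2_def)
  moreover have "a = x * a * inverse x" "b = x * b * inverse x"
    using x0 by auto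
  ultimately show ?thesis
    using xab by blast
qed

text \<open>Choose (x) maximal among the principal ideals generated by elements of \<open>J\<close>.
  For \<open>y\<close> in \<open>J\<close> the ideal (x, y) has a single generator \<open>z\<close>
  in \<open>J\<close>, and maximality forces (z) = (x), so \<open>y\<close> lies in (x).\<close>

lemma principal_if_colon_principal:
  assumes colon: "\<And>a b. a \<in> \<O> \<Longrightarrow> b \<in> \<O> \<Longrightarrow> a \<noteq> 0 \<Longrightarrow> b \<noteq> 0 \<Longrightarrow> \<exists>x. colon a b = (*) x ` \<O>"
    and J: "ideal J R"
  shows "\<exists>x. J = (*) x ` \<O>"
proof -
  have id: "ideal ((*) x ` \<O>) R" if "x \<in> \<O>" for x
    unfolding ideal_iff
  proof (intro conjI ballI)
    show "(*) x ` \<O> \<subseteq> \<O>" "0 \<in> (*) x ` \<O>"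
      using that mult_mem zero_mem by (auto intro: image_eqI[of _ _ 0])
  next
    fix u v assume "u \<in> (*) x ` \<O>" "v \<in> (*) x ` \<O>"
    then show "u + v \<in> (*) x ` \<O>"
      using add_mem by (auto simp flip: distrib_left)
  next
    fix u v assume "u \<in> \<O>" "v \<in> (*) x ` \<O>"
    then show "u * v \<in> (*) x ` \<O>"
      using mult_mem by (auto simp: mult.left_commute[of u x])
  qed
  note J' = J[unfolded ideal_iff]
  define \<S> where "\<S> = {(*) x ` \<O> | x. x \<in> J}"
  have "\<S> \<noteq> {}"
    using J' by (auto simp: \<S>_def)
  then obtain x where x: "x \<in> J"
    and max: "\<And>z. z \<in> J \<Longrightarrow> (*) x ` \<O> \<subseteq> (*) z ` \<O> \<Longrightarrow> (*) z ` \<O> = (*) x ` \<O>"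
  proof -
    have "\<And>B. B \<in> \<S> \<Longrightarrow> ideal B R"
      using id J' by (auto simp: \<S>_def)
    then obtain B where "B \<in> \<S>" and B: "\<And>B'. B' \<in> \<S> \<Longrightarrow> B \<subseteq> B' \<Longrightarrow> B' = B"
      using noetherian_maximal_ideal[OF noetherian \<open>\<S> \<noteq> {}\<close>] by blast
    then obtain x where "x \<in> J" "B = (*) x ` \<O>"
      by (auto simp: \<S>_def)
    moreover have "(*) z ` \<O> = (*) x ` \<O>" if "z \<in> J" "(*) x ` \<O> \<subseteq> (*) z ` \<O>" for z
      using B[of "(*) z ` \<O>"] that \<open>B = (*) x ` \<O>\<close> unfolding \<S>_def by blast
    ultimately show thesis
      using that by blast
  qed
  have self: "z \<in> (*) z ` \<O>" for z
    using one_mem by (auto intro: image_eqI[of _ _ 1])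
  have "y \<in> (*) x ` \<O>" if y: "y \<in> J" for y
  \<comment> \<open>The hypothesis on colon ideals speaks of nonzero elements only. If
    \<open>x = 0\<close>, maximality compares (x) directly with (y).\<close>
  proof (cases "x = 0 \<or> y = 0")
    case True
    then show ?thesis
    proof
      assume "x = 0"
      then have "(*) x ` \<O> \<subseteq> (*) y ` \<O>"
        using zero_mem by (auto intro: image_eqI[of _ _ 0])
      then show ?thesis
        using max[OF y] self by metis
    next
      assume "y = 0"
      then show ?thesis
        using zero_mem by (auto intro: image_eqI[of _ _ 0])
    qed
  next
    case False
    then have xy: "x \<in> \<O>" "y \<in> \<O>" "x \<noteq> 0" "y \<noteq> 0"
      using x y J' by auto
    then obtain z s t where z: "z \<in> ideal2 x y" "s \<in> \<O>" "t \<in> \<O>" "x = s * z" "y = t * z"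
      using colon[OF xy] ideal2_principal[of x y] by metis
    have "z \<in> J"
      using z(1) x y J' by (auto simp: ideal2_def)
    moreover have "(*) x ` \<O> \<subseteq> (*) z ` \<O>"
      using z(2,4) mult_mem by (auto simp: ac_simps)
    ultimately have "(*) z ` \<O> = (*) x ` \<O>"
      by (rule max)
    then show ?thesis
      using z(3,5) by (auto simp: ac_simps)
  qed
  then have "J = (*) x ` \<O>"
    using x J' by (auto simp: mult.commute)
  then show ?thesis ..
qed

section \<open>Principal fractional ideals and the class group\<close>

lemma ideal_prod_principal:
  "ideal_prod ring_of_type_algebra ((*) x ` \<O>) ((*) y ` \<O>) = (*) (x * y) ` \<O>" (is "?L = ?R")
proof
  show "?L \<subseteq> ?R"
  proof
    fix s assume "s \<in> ?L"
    then show "s \<in> ?R"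
    proof induction
      case (prod i j)
      then obtain p q where "p \<in> \<O>" "q \<in> \<O>" "i = x * p" "j = y * q" by auto
      then show ?case
        by (auto simp: ring_of_type_algebra_def mult_mem intro!: image_eqI[of _ _ "p * q"])
    next
      case (sum s1 s2)
      then show ?case
        by (auto simp: ring_of_type_algebra_def add_mem simp flip: distrib_left)
    qed
  qed
  show "?R \<subseteq> ?L"
  proof
    fix s assume "s \<in> ?R"
    then obtain p where p: "p \<in> \<O>" "s = x * p * (y * 1)" by (auto simp: ac_simps)
    have "x * p \<otimes>\<^bsub>ring_of_type_algebra\<^esub> (y * 1) \<in> ?L"
      using p one_mem by (intro ideal_prod.prod) auto
    then show "s \<in> ?L"
      using p by (simp add: ring_of_type_algebra_def)
  qed
qed

text \<open>Clearing a denominator \<open>d\<close> turns a fractional ideal into an ideal, so it is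
  generated by a single \<open>y\<close>. Its coset is computed as a set: multiplication by
  \<open>y\<close> permutes the nonzero elements of the field, hence also the principal fractional
  ideals.\<close>

lemma class_group_trivial:
  assumes frac: "fractions \<O> = UNIV"
    and pr: "\<And>J. ideal J R \<Longrightarrow> \<exists>x. J = (*) x ` \<O>"
  shows "carrier (class_group \<O>) \<subseteq> {principal_fractional_ideals \<O>}"
proof
  let ?G = "fractional_ideal_group \<O>" and ?H = "principal_fractional_ideals \<O>"
  have H: "?H = {(*) x ` \<O> | x. x \<noteq> 0}"
    by (simp add: principal_fractional_ideals_def frac)
  fix A assume "A \<in> carrier (class_group \<O>)"
  then obtain I where I: "fractional_ideal \<O> I" and A: "A = ?H #>\<^bsub>?G\<^esub> I"
    by (auto simp: class_group_def FactGroup_def RCOSETS_def fractional_ideal_group_def)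
  then obtain d where d: "d \<in> \<O>" "d \<noteq> 0" "\<And>x. x \<in> I \<Longrightarrow> d * x \<in> \<O>"
    unfolding fractional_ideal_def by blast
  have "ideal ((*) d ` I) R"
    unfolding ideal_iff
  proof (intro conjI ballI)
    show "(*) d ` I \<subseteq> \<O>" "0 \<in> (*) d ` I"
      using I d(3) by (auto simp: fractional_ideal_def intro: image_eqI[of _ _ 0])
  next
    fix u v assume "u \<in> (*) d ` I" "v \<in> (*) d ` I"
    then obtain u' v' where "u' \<in> I" "v' \<in> I" "u = d * u'" "v = d * v'" by blast
    then show "u + v \<in> (*) d ` I"
      using I by (auto simp: fractional_ideal_def distrib_left intro!: image_eqI[of _ _ "u' + v'"])
  next
    fix u v assume "u \<in> \<O>" "v \<in> (*) d ` I"
    then obtain v' where "u \<in> \<O>" "v' \<in> I" "v = d * v'" by blast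
    then show "u * v \<in> (*) d ` I"
      using I by (auto simp: fractional_ideal_def intro!: image_eqI[of _ _ "u * v'"])
  qed
  then obtain x where x: "(*) d ` I = (*) x ` \<O>"
    using pr by blast
  have "I = (*) (inverse d) ` (*) d ` I"
    using d by (auto simp: image_image mult.assoc[symmetric])
  also have "\<dots> = (*) (x / d) ` \<O>"
    unfolding x by (simp add: image_image field_simps)
  finally have I': "I = (*) (x / d) ` \<O>" .
  moreover have "I \<noteq> {0}"
    using I by (simp add: fractional_ideal_def)
  ultimately have x0: "x \<noteq> 0"
    using zero_mem by auto
  define y where "y = x / d"
  have y: "I = (*) y ` \<O>" "y \<noteq> 0"
    using I' x0 d by (auto simp: y_def)
  have "A = (\<lambda>h. ideal_prod ring_of_type_algebra h ((*) y ` \<O>)) ` ?H"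
    unfolding A r_coset_def y(1) by (auto simp: fractional_ideal_group_def)
  also have "?H = (\<lambda>z. (*) z ` \<O>) ` (- {0})"
    unfolding H by auto
  also have "(\<lambda>h. ideal_prod ring_of_type_algebra h ((*) y ` \<O>)) ` \<dots>
      = (\<lambda>z. (*) z ` \<O>) ` (\<lambda>z. z * y) ` (- {0})"
    by (simp only: image_image ideal_prod_principal)
  also have "(\<lambda>z. z * y) ` (- {0}) = - {0}"
  proof (intro subset_antisym subsetI)
    fix z :: 'k assume "z \<in> - {0}"
    then show "z \<in> (\<lambda>z. z * y) ` (- {0})"
      using y(2) by (auto intro!: image_eqI[of _ _ "z / y"])
  qed (use y(2) in auto)
  also have "(\<lambda>z. (*) z ` \<O>) ` (- {0}) = ?H"
    unfolding H by auto
  finally show "A \<in> {?H}"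
    by simp
qed

lemma exists_nonprincipal_colon:
  assumes "fractions \<O> = UNIV" "1 < card (carrier (class_group \<O>))"
  obtains a b where "a \<in> \<O>" "b \<in> \<O>" "a \<noteq> 0" "b \<noteq> 0" "\<And>x. colon a b \<noteq> (*) x ` \<O>"
proof -
  have "\<not> (\<forall>J. ideal J R \<longrightarrow> (\<exists>x. J = (*) x ` \<O>))"
  proof
    assume "\<forall>J. ideal J R \<longrightarrow> (\<exists>x. J = (*) x ` \<O>)"
    then have "carrier (class_group \<O>) \<subseteq> {principal_fractional_ideals \<O>}"
      using class_group_trivial assms(1) by blast
    from card_mono[OF _ this] show False
      using assms(2) by simp
  qed
  then show thesis
    using principal_if_colon_principal that by blast
qed

end

section \<open>Top-dimensional cycles of the building\<close>

lemma frag_extend_frag_extend: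
  "frag_extend g (frag_extend f c) = frag_extend (\<lambda>s. frag_extend g (f s)) c"
  unfolding frag_extend_def[of f c] frag_extend_def[of "\<lambda>s. frag_extend g (f s)" c]
  by (simp add: frag_extend_sum frag_extend_cmul)

text \<open>Determines the terms of chains of the greatest possible length: full flags begin with a
  line, and the \<open>j\<close>-th of \<open>n + 1\<close> nested subsets of an
  \<open>n\<close>-element set has \<open>j\<close> elements.\<close>

lemma strict_chain_gap:
  fixes f :: "nat \<Rightarrow> nat"
  assumes "\<And>i. Suc i < m \<Longrightarrow> f i < f (Suc i)" "i \<le> j" "j < m"
  shows "f i + (j - i) \<le> f j"
  using assms(2,3)
proof (induction j rule: dec_induct)
  case (step j)
  then show ?case
    using assms(1)[of j] by simp
qed simp

text \<open>A free abelian group has no 2-torsion; this turns a sign-reversing reindexing of a sum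
  into its vanishing.\<close>

lemma frag_eq_neg_self:
  fixes x :: "'a \<Rightarrow>\<^sub>0 int"
  assumes "x = - x"
  shows "x = 0"
proof (rule poly_mapping_eqI)
  fix a
  have "Poly_Mapping.lookup x a = - Poly_Mapping.lookup x a"
    by (metis assms lookup_uminus)
  then show "Poly_Mapping.lookup x a = Poly_Mapping.lookup 0 a"
    by simp
qed

section \<open>Dimensions along the flags of the building\<close>

lemma tits_building_nth:
  assumes "s \<in> tits_building" "i < length s"
  shows "vec.subspace (s ! i)" "s ! i \<noteq> {0}" "s ! i \<noteq> UNIV"
  using assms by (auto simp: tits_building_def)

lemma subspace_dim_strict_mono:
  fixes V W :: "('k::field ^ 'n) set"
  assumes "vec.subspace V" "vec.subspace W" "V \<subset> W"
  shows "vec.dim V < vec.dim W"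
  using assms by (intro vec.dim_psubset) (simp add: vec.span_eq_iff[THEN iffD2])

lemma tits_building_dim_less:
  fixes s :: "('k::field ^ 'n) set list"
  assumes "s \<in> tits_building" "i < j" "j < length s"
  shows "vec.dim (s ! i) < vec.dim (s ! j)"
proof (rule subspace_dim_strict_mono)
  show "s ! i \<subset> s ! j"
    using assms by (auto simp: tits_building_def sorted_wrt_iff_nth_less)
qed (use assms tits_building_nth[OF assms(1)] in auto)

lemma tits_building_dim_bounds:
  fixes s :: "('k::field ^ 'n) set list"
  assumes "s \<in> tits_building" "i < length s"
  shows "1 \<le> vec.dim (s ! i)" "vec.dim (s ! i) < CARD('n)"
proof -
  have "vec.dim {0 :: 'k ^ 'n} < vec.dim (s ! i)"
    using tits_building_nth[OF assms] vec.subspace_0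
    by (intro subspace_dim_strict_mono) auto
  then show "1 \<le> vec.dim (s ! i)"
    by simp
  have "vec.dim (s ! i) < vec.dim (UNIV :: ('k ^ 'n) set)"
    using tits_building_nth[OF assms] by (intro subspace_dim_strict_mono) auto
  then show "vec.dim (s ! i) < CARD('n)"
    by (simp only: vec_dim_card)
qed

lemma tits_building_dim_gap:
  fixes s :: "('k::field ^ 'n) set list"
  assumes "s \<in> tits_building" "i < length s"
  shows "vec.dim (s ! 0) + i \<le> vec.dim (s ! i)"
  using strict_chain_gap[of "length s" "\<lambda>i. vec.dim (s ! i)" 0 i] assms tits_building_dim_less[of s]
  by simp

lemma tits_building_length_less:
  fixes s :: "('k::field ^ 'n) set list"
  assumes "s \<in> tits_building"
  shows "length s < CARD('n)"
proof (cases "s = []")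
  case False
  then have l: "length s - 1 < length s" "0 < length s" by auto
  show ?thesis
    using tits_building_dim_gap[OF assms l(1)] tits_building_dim_bounds[OF assms l(1)]
      tits_building_dim_bounds(1)[OF assms l(2)] by linarith
qed simp

section \<open>The Steinberg module as the group of top-dimensional cycles\<close>

context
  assumes n2: "2 \<le> CARD('n::finite)"
begin

abbreviation (input) "top_cycles \<equiv>
  reduced_cycles (CARD('n) - 2) (tits_building :: ('k::field ^ 'n) set list set)"

text \<open>A flag has fewer than \<open>n\<close> members, so there are no chains one dimension up.
  Homology classes therefore become singletons \<open>{c}\<close>, and the Steinberg module can be
  calculated with cycles.\<close>

lemma tits_building_boundaries:
  "simplicial_boundaries (CARD('n) - 2) (tits_building :: ('k::field ^ 'n) set list set) = {0}"
proof -
  have "{s \<in> (tits_building :: ('k ^ 'n) set list set). length s = Suc (Suc (CARD('n) - 2))} = {}"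
    using tits_building_length_less[where ?'k = 'k and ?'n = 'n] n2 by fastforce
  then have "carrier (simplicial_chain_group (Suc (CARD('n) - 2)) (tits_building :: ('k ^ 'n) set list set)) = {0}"
    unfolding simplicial_chain_group_def by (simp only:) auto
  then show ?thesis
    by (simp add: simplicial_boundaries_def simplicial_boundary_def)
qed

lemma tits_building_homology_class:
  "simplicial_homology_class (CARD('n) - 2) (tits_building :: ('k::field ^ 'n) set list set) c = {c}"
  by (simp add: simplicial_homology_class_def tits_building_boundaries r_coset_def
      reduced_cycle_group_def simplicial_chain_group_def)

lemma carrier_steinberg:
  "carrier (steinberg :: (('k::field ^ 'n) set list \<Rightarrow>\<^sub>0 int) set monoid) = (\<lambda>c. {c}) ` top_cycles"
proof -
  have "carrier (reduced_cycle_group (CARD('n) - 2) (tits_building :: ('k ^ 'n) set list set)) = top_cycles"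
    by (simp add: reduced_cycle_group_def)
  then show ?thesis
    unfolding steinberg_def reduced_simplicial_homology_def carrier_FactGroup
    by (intro image_cong) (simp_all add: tits_building_homology_class[unfolded simplicial_homology_class_def])
qed

lemma mult_steinberg:
  "{c} \<otimes>\<^bsub>steinberg :: (('k::field ^ 'n) set list \<Rightarrow>\<^sub>0 int) set monoid\<^esub> {d} = {c + d}"
  by (simp add: steinberg_def reduced_simplicial_homology_def set_mult_def
      reduced_cycle_group_def simplicial_chain_group_def)

lemma one_steinberg: "\<one>\<^bsub>steinberg :: (('k::field ^ 'n) set list \<Rightarrow>\<^sub>0 int) set monoid\<^esub> = {0}"
  by (simp add: steinberg_def reduced_simplicial_homology_def tits_building_boundaries)

lemma top_cycles_closed:
  fixes c d :: "('k::field ^ 'n) set list \<Rightarrow>\<^sub>0 int"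
  shows "0 \<in> (top_cycles :: (('k ^ 'n) set list \<Rightarrow>\<^sub>0 int) set)"
    and "c \<in> top_cycles \<Longrightarrow> - c \<in> top_cycles"
    and "c \<in> top_cycles \<Longrightarrow> d \<in> top_cycles \<Longrightarrow> c + d \<in> top_cycles"
  using Poly_Mapping.keys_add[of c d]
  by (auto simp: reduced_cycles_def simplicial_chain_group_def simplicial_boundary_def
      frag_extend_minus frag_extend_add)

lemma inv_steinberg:
  assumes "c \<in> top_cycles"
  shows "inv\<^bsub>steinberg :: (('k::field ^ 'n) set list \<Rightarrow>\<^sub>0 int) set monoid\<^esub> {c} = {- c}"
  unfolding m_inv_def
proof (rule the_equality)
  show "{- c} \<in> carrier steinberg \<and> {c} \<otimes>\<^bsub>steinberg\<^esub> {- c} = \<one>\<^bsub>steinberg\<^esub> \<and>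
      {- c} \<otimes>\<^bsub>steinberg\<^esub> {c} = \<one>\<^bsub>steinberg\<^esub>"
    using top_cycles_closed(2)[OF assms] by (auto simp: carrier_steinberg mult_steinberg one_steinberg)
  fix y
  assume "y \<in> carrier steinberg \<and> {c} \<otimes>\<^bsub>steinberg\<^esub> y = \<one>\<^bsub>steinberg\<^esub> \<and>
      y \<otimes>\<^bsub>steinberg\<^esub> {c} = \<one>\<^bsub>steinberg\<^esub>"
  then show "y = {- c}"
    by (auto simp: carrier_steinberg mult_steinberg one_steinberg add_eq_0_iff)
qed

text \<open>
  The building has no \<open>(n - 1)\<close>-simplices, so every function on the maximal flags induces a
  homomorphism on the Steinberg module.
\<close>

lemma generate_steinberg_kernel:
  fixes G :: "(('k::field ^ 'n) set list \<Rightarrow>\<^sub>0 int) set set"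
  assumes "G \<subseteq> (\<lambda>c. {c}) ` {c \<in> top_cycles. frag_extend f c = 0}"
  shows "generate steinberg G \<subseteq> (\<lambda>c. {c}) ` {c \<in> top_cycles. frag_extend f c = 0}"
proof
  fix A assume "A \<in> generate steinberg G"
  then show "A \<in> (\<lambda>c. {c}) ` {c \<in> top_cycles. frag_extend f c = 0}"
  proof induction
    case one
    then show ?case
      using top_cycles_closed(1) by (auto simp: one_steinberg)
  next
    case (incl h)
    then show ?case using assms by blast
  next
    case (inv h)
    then obtain c where "h = {c}" "c \<in> top_cycles" "frag_extend f c = 0"
      using assms by blast
    then show ?case
      using top_cycles_closed(2)[of c] by (auto simp: inv_steinberg frag_extend_minus)
  next
    case (eng h1 h2)
    then obtain c d where "h1 = {c}" "c \<in> top_cycles" "frag_extend f c = 0"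
        "h2 = {d}" "d \<in> top_cycles" "frag_extend f d = 0"
      by blast
    then show ?case
      using top_cycles_closed(3)[of c d] by (auto simp: mult_steinberg frag_extend_add)
  qed
qed

text \<open>
  The sum of the coefficients of a cycle is the sum of the coefficients of its boundary at the
  faces without a line, because exactly one face of a maximal flag contains no line.
\<close>

lemma top_cycle_coefficient_sum:
  fixes z :: "('k::field ^ 'n) set list \<Rightarrow>\<^sub>0 int"
  assumes "z \<in> top_cycles"
  shows "frag_extend (\<lambda>s. frag_of ()) z = 0"
proof -
  \<comment> \<open>The free abelian group on \<open>unit\<close> stands for the integers, so that
    integer-valued homomorphisms are written with \<open>frag_extend\<close>.\<close>
  define g :: "('k ^ 'n) set list \<Rightarrow> unit \<Rightarrow>\<^sub>0 int"
    where "g s = (if \<forall>V\<in>set s. vec.dim V \<noteq> 1 then frag_of () else 0)" for s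
  have keys: "s \<in> tits_building \<and> length s = CARD('n) - 1" if "s \<in> Poly_Mapping.keys z" for s
    using that assms n2 by (auto simp: reduced_cycles_def simplicial_chain_group_def)
  have face: "frag_extend g (\<Sum>i<length s. frag_cmul ((-1) ^ i) (frag_of (take i s @ drop (Suc i) s)))
      = frag_of ()" if "s \<in> Poly_Mapping.keys z" for s
  proof -
    have s: "s \<in> tits_building" "length s = CARD('n) - 1"
      using keys[OF that] by auto
    then have l: "length s - 1 < length s" "0 < length s"
      using n2 by auto
    \<comment> \<open>The last of the \<open>n - 1\<close> dimensions is at most
      \<open>n - 1\<close> and exceeds the first by at least \<open>n - 2\<close>.\<close>
    have d1: "vec.dim (s ! 0) = 1"
      using tits_building_dim_gap[OF s(1) l(1)] tits_building_dim_bounds[OF s(1) l(1)]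
        tits_building_dim_bounds[OF s(1) l(2)] s(2) n2 by linarith
    have "g (take i s @ drop (Suc i) s) = (if i = 0 then frag_of () else 0)" if i: "i < length s" for i
    proof (cases "i = 0")
      case True
      have "vec.dim V \<noteq> 1" if V: "V \<in> set (drop (Suc 0) s)" for V
      proof -
        obtain j where "j < length s - 1" "V = s ! Suc j"
          using V by (auto simp: in_set_conv_nth)
        then have "1 < vec.dim V"
          using tits_building_dim_less[OF s(1), of 0 "Suc j"] d1 by simp
        then show ?thesis by simp
      qed
      then show ?thesis
        using True by (simp add: g_def)
    next
      case False
      then have "s ! 0 \<in> set (take i s)"
        using l by (auto simp: in_set_conv_nth intro!: exI[of _ 0])
      then show ?thesis
        using False d1 by (auto simp: g_def)
    qed
    then have "frag_extend g (\<Sum>i<length s. frag_cmul ((-1) ^ i) (frag_of (take i s @ drop (Suc i) s)))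
        = (\<Sum>i<length s. if i = 0 then frag_of () else 0)"
      unfolding frag_extend_sum[OF finite_lessThan] by (intro sum.cong) (auto simp: frag_extend_cmul)
    then show ?thesis
      using l by simp
  qed
  have "frag_extend (\<lambda>s. frag_of ()) z = frag_extend g (simplicial_boundary z)"
    unfolding simplicial_boundary_def frag_extend_frag_extend
    by (rule frag_extend_eq) (simp add: face)
  also have "simplicial_boundary z = 0"
    using assms by (simp add: reduced_cycles_def)
  finally show ?thesis
    by simp
qed

end

section \<open>Flags with cyclic successive quotients\<close>

text \<open>The vector \<open>w\<close> lifts a generator of the quotient of the lattice points of
  \<open>W\<close> by those of \<open>U\<close>, which avoids forming a quotient module.\<close>

definition cyclic_step :: "'k::field set \<Rightarrow> ('k ^ 'n) set \<Rightarrow> ('k ^ 'n) set \<Rightarrow> bool" where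
  "cyclic_step \<O> U W \<longleftrightarrow>
     (\<exists>w \<in> W \<inter> lattice_of \<O>. \<forall>x \<in> W \<inter> lattice_of \<O>. \<exists>t\<in>\<O>. x - t *s w \<in> U)"

text \<open>With both ends added, entry \<open>j\<close> of a maximal flag has dimension
  \<open>j\<close>.\<close>

definition full_flag :: "('k::field ^ 'n) set list \<Rightarrow> ('k ^ 'n) set list" where
  "full_flag s = {0} # s @ [UNIV]"

definition cyclic_flag :: "'k::field set \<Rightarrow> ('k ^ 'n) set list \<Rightarrow> bool" where
  "cyclic_flag \<O> s \<longleftrightarrow> (\<forall>j \<le> length s. cyclic_step \<O> (full_flag s ! j) (full_flag s ! Suc j))"

text \<open>A vector in the span of the lines in \<open>S\<close> is a sum of components from
  \<open>S\<close>. Extended by zero, these give a second decomposition along the frame, and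
  decompositions are unique.\<close>

lemma frame_component_zero:
  fixes \<L> :: "('k::field ^ 'n) set set"
  assumes fr: "frame \<L>" and f: "\<And>M. M \<in> \<L> \<Longrightarrow> f M \<in> M"
    and S: "S \<subseteq> \<L>" "(\<Sum>M\<in>\<L>. f M) \<in> vec.span (\<Union>S)" and M: "M \<in> \<L>" "M \<notin> S"
  shows "f M = 0"
proof -
  have sub: "vec.subspace M" if "M \<in> \<L>" for M
    using fr that by (auto simp: frame_def)
  have fin: "finite \<L>" and inj: "inj_on (\<lambda>f. \<Sum>M\<in>\<L>. f M) (\<Pi>\<^sub>E M\<in>\<L>. M)"
    using fr by (auto simp: frame_def is_direct_sum_def bij_betw_def)
  have "\<exists>g. (\<forall>M\<in>S. g M \<in> M) \<and> x = (\<Sum>M\<in>S. g M)" if "x \<in> vec.span (\<Union>S)" for x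
    using finite_subset[OF S(1) fin] S(1) that
  proof (induction arbitrary: x rule: finite_induct)
    case empty
    then show ?case by simp
  next
    case (insert L T)
    have "vec.span L = L"
      using insert.prems(1) sub by (simp add: vec.span_eq_iff)
    moreover have "x \<in> {l + u | l u. l \<in> vec.span L \<and> u \<in> vec.span (\<Union>T)}"
      using insert.prems(2) by (simp only: Union_insert vec.span_Un)
    ultimately obtain l u where lu: "x = l + u" "l \<in> L" "u \<in> vec.span (\<Union>T)"
      by blast
    obtain g where "\<forall>M\<in>T. g M \<in> M" "u = (\<Sum>M\<in>T. g M)"
      using insert.IH[OF _ lu(3)] insert.prems(1) by auto
    moreover have "(\<Sum>M\<in>T. (g(L := l)) M) = (\<Sum>M\<in>T. g M)"
      using insert.hyps by (intro sum.cong) auto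
    ultimately show ?case
      using lu insert.hyps by (intro exI[of _ "g(L := l)"]) auto
  qed
  from this[OF S(2)] obtain g where g: "\<And>M. M \<in> S \<Longrightarrow> g M \<in> M" "(\<Sum>M\<in>\<L>. f M) = (\<Sum>M\<in>S. g M)"
    by blast
  define h where "h M = (if M \<in> S then g M else 0)" for M
  \<comment> \<open>Injectivity is known only on extensional functions, so both families are
    restricted to the frame.\<close>
  have "(\<Sum>M\<in>\<L>. restrict f \<L> M) = (\<Sum>M\<in>\<L>. f M)"
    by (intro sum.cong) auto
  also have "\<dots> = (\<Sum>M\<in>\<L>. h M)"
    unfolding g(2) h_def using fin S(1)
    by (intro sum.mono_neutral_cong_left) auto
  also have "\<dots> = (\<Sum>M\<in>\<L>. restrict h \<L> M)"
    by (intro sum.cong) auto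
  finally have "restrict f \<L> = restrict h \<L>"
    using f g(1) vec.subspace_0[OF sub] by (intro inj_onD[OF inj]) (auto simp: h_def)
  then show ?thesis
    using M by (metis h_def restrict_apply')
qed

text \<open>By integrality each lattice point of the larger span is congruent, modulo the smaller
  one, to a lattice point of \<open>L\<close>. Since \<open>L\<close> meets the smaller span only in
  0, the quotient is the module of lattice points of \<open>L\<close>.\<close>

lemma cyclic_step_frame:
  fixes \<L> :: "('k::field ^ 'n) set set"
  assumes int: "integral_frame \<O> \<L>" and T: "T \<subseteq> \<L>" and L: "L \<in> \<L>" "L \<notin> T"
  shows "cyclic_step \<O> (vec.span (\<Union>T)) (vec.span (\<Union>(insert L T))) \<longleftrightarrow> cyclic_step \<O> {0} L"
    (is "cyclic_step \<O> ?U ?W \<longleftrightarrow> _")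
proof -
  have fr: "frame \<L>"
    using int by (simp add: integral_frame_def)
  then have fin: "finite \<L>"
    by (simp add: frame_def is_direct_sum_def)
  have sub: "vec.subspace M" if "M \<in> \<L>" for M
    using fr that by (auto simp: frame_def)
  have LW: "L \<subseteq> ?W"
    using vec.span_superset[of "\<Union>(insert L T)"] by auto
  have proj: "\<exists>l \<in> L \<inter> lattice_of \<O>. x - l \<in> ?U" if x: "x \<in> ?W" "x \<in> lattice_of \<O>" for x
  proof -
    have "x \<in> (\<lambda>f. \<Sum>M\<in>\<L>. f M) ` (\<Pi>\<^sub>E M\<in>\<L>. M \<inter> lattice_of \<O>)"
      using int x(2) by (auto simp: integral_frame_def is_direct_sum_def bij_betw_def)
    then obtain f where f: "\<And>M. M \<in> \<L> \<Longrightarrow> f M \<in> M \<inter> lattice_of \<O>" "x = (\<Sum>M\<in>\<L>. f M)"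
      by auto
    have "f M = 0" if "M \<in> \<L>" "M \<notin> insert L T" for M
      using f x(1) T L that by (intro frame_component_zero[OF fr, of f "insert L T"]) auto
    then have "x = (\<Sum>M\<in>insert L T. f M)"
      unfolding f(2) using T L fin by (intro sum.mono_neutral_right) auto
    then have "x - f L = (\<Sum>M\<in>T. f M)"
      using L(2) finite_subset[OF T fin] by simp
    also have "\<dots> \<in> ?U"
      using f(1) T by (intro vec.span_sum vec.span_base) auto
    finally show ?thesis
      using f(1)[OF L(1)] by blast
  qed
  have indep: "x = 0" if "x \<in> L" "x \<in> ?U" for x
  proof -
    have "(if L = L then x else 0) = 0"
      using that fin L sub vec.subspace_0 T
      by (intro frame_component_zero[OF fr, of "\<lambda>M. if M = L then x else 0" T L]) auto
    then show ?thesis by simp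
  qed
  show ?thesis
  proof
    assume "cyclic_step \<O> ?U ?W"
    then obtain w where w: "w \<in> ?W" "w \<in> lattice_of \<O>"
      and wx: "\<And>x. x \<in> ?W \<Longrightarrow> x \<in> lattice_of \<O> \<Longrightarrow> \<exists>t\<in>\<O>. x - t *s w \<in> ?U"
      by (auto simp: cyclic_step_def)
    \<comment> \<open>The generator \<open>w\<close> is replaced by its component in
      \<open>L\<close>, which is congruent to it modulo \<open>?U\<close>.\<close>
    obtain l where l: "l \<in> L \<inter> lattice_of \<O>" "w - l \<in> ?U"
      using proj[OF w] by blast
    have "\<exists>t\<in>\<O>. x - t *s l = 0" if x: "x \<in> L" "x \<in> lattice_of \<O>" for x
    proof -
      obtain t where t: "t \<in> \<O>" "x - t *s w \<in> ?U"
        using wx x LW by blast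
      have "x - t *s l = (x - t *s w) + t *s (w - l)"
        by (simp add: algebra_simps vec.scale_right_diff_distrib)
      also have "\<dots> \<in> ?U"
        using t l by (intro vec.span_add vec.span_scale)
      finally have "x - t *s l \<in> ?U" .
      moreover have "x - t *s l \<in> L"
        using x l sub[OF L(1)] by (auto intro: vec.subspace_diff vec.subspace_scale)
      ultimately show ?thesis
        using indep t(1) by blast
    qed
    then show "cyclic_step \<O> {0} L"
      using l(1) by (auto simp: cyclic_step_def)
  next
    assume "cyclic_step \<O> {0} L"
    then obtain w where w: "w \<in> L" "w \<in> lattice_of \<O>"
      and wx: "\<And>x. x \<in> L \<Longrightarrow> x \<in> lattice_of \<O> \<Longrightarrow> \<exists>t\<in>\<O>. x = t *s w"
      by (auto simp: cyclic_step_def)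
    have "\<exists>t\<in>\<O>. x - t *s w \<in> ?U" if "x \<in> ?W" "x \<in> lattice_of \<O>" for x
      using proj[OF that] wx by blast
    then show "cyclic_step \<O> ?U ?W"
      using w LW by (auto simp: cyclic_step_def)
  qed
qed

lemma full_flag_psubset:
  fixes s :: "('k::field ^ 'n) set list"
  assumes "s \<in> tits_building" "j \<le> length s"
  shows "full_flag s ! j \<subset> full_flag s ! Suc j"
proof -
  have "UNIV \<noteq> {0 :: 'k ^ 'n}"
    by (metis UNIV_I singletonD zero_neq_one)
  then have "sorted_wrt (\<subset>) (full_flag s)"
    using assms(1) vec.subspace_0
    by (fastforce simp: full_flag_def tits_building_def sorted_wrt_append)
  then show ?thesis
    using assms(2) by (intro sorted_wrt_nth_less[of "(\<subset>)"]) (auto simp: full_flag_def)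
qed

text \<open>A full flag of the apartment adds the lines of the frame one at a time. Its successive
  quotients are thus the modules of lattice points of the lines, each occurring once.\<close>

lemma cyclic_flag_apartment:
  fixes \<L> :: "('k::field ^ 'n) set set"
  assumes int: "integral_frame \<O> \<L>" and s: "s \<in> apartment \<L>" "length s = CARD('n) - 1"
  shows "cyclic_flag \<O> s \<longleftrightarrow> (\<forall>L\<in>\<L>. cyclic_step \<O> {0} L)"
proof -
  have fr: "frame \<L>"
    using int by (simp add: integral_frame_def)
  then have fin: "finite \<L>" and card: "card \<L> = CARD('n)"
    by (simp_all add: frame_def is_direct_sum_def)
  have dim: "vec.dim M = 1" if "M \<in> \<L>" for M
    using fr that by (auto simp: frame_def)
  have st: "s \<in> tits_building"
    using s by (simp add: apartment_def)
  have len: "length s < CARD('n)" "Suc (length s) = CARD('n)"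
    using s(2) by simp_all
  define V where "V j = full_flag s ! j" for j
  \<comment> \<open>Taking all lines inside \<open>V j\<close>, rather than a chosen spanning set,
    makes \<open>T\<close> monotone at once.\<close>
  define T where "T j = {L \<in> \<L>. L \<subseteq> V j}" for j
  have V0: "V 0 = {0}" and Vn: "V (CARD('n)) = UNIV"
    unfolding len(2)[symmetric] by (simp_all add: V_def full_flag_def nth_append)
  have T0: "T 0 = {}"
  proof -
    have "\<not> L \<subseteq> {0}" if "L \<in> \<L>" for L
      using dim[OF that] vec.dim_subset[of L "{0}"] by auto
    then show ?thesis by (auto simp: T_def V0)
  qed
  have Tn: "T (CARD('n)) = \<L>"
    by (auto simp: T_def Vn)
  have V_span: "\<exists>S\<subseteq>\<L>. V j = vec.span (\<Union>S)" if j: "j \<le> CARD('n)" for j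
  proof -
    consider "j = 0" | "j = CARD('n)" | i where "j = Suc i" "i < length s"
      using j len by (cases j) (auto simp: le_less)
    then show ?thesis
    proof cases
      case 1
      then show ?thesis by (intro exI[of _ "{}"]) (simp add: V0)
    next
      case 2
      have "x \<in> vec.span (\<Union>\<L>)" for x
      proof -
        have "x \<in> (\<lambda>f. \<Sum>M\<in>\<L>. f M) ` (\<Pi>\<^sub>E M\<in>\<L>. M)"
          using fr by (auto simp: frame_def is_direct_sum_def bij_betw_def)
        then obtain f where "\<And>M. M \<in> \<L> \<Longrightarrow> f M \<in> M" "x = (\<Sum>M\<in>\<L>. f M)"
          by auto
        then show ?thesis
          using vec.span_sum[of \<L> f "\<Union>\<L>"] vec.span_base[of _ "\<Union>\<L>"] by blast
      qed
      then show ?thesis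
        using 2 Vn by (intro exI[of _ \<L>]) auto
    next
      case 3
      then have "V j \<in> set s"
        by (simp add: V_def full_flag_def nth_append)
      then show ?thesis
        using s(1) unfolding apartment_def by blast
    qed
  qed
  have V_T: "V j = vec.span (\<Union>(T j))" if j: "j \<le> CARD('n)" for j
  proof -
    obtain S where S: "S \<subseteq> \<L>" "V j = vec.span (\<Union>S)"
      using V_span[OF j] by blast
    then have "S \<subseteq> T j"
      using vec.span_superset[of "\<Union>S"] by (auto simp: T_def)
    then have "V j \<subseteq> vec.span (\<Union>(T j))"
      unfolding S(2) by (intro vec.span_mono) auto
    moreover have "vec.span (\<Union>(T j)) \<subseteq> V j"
      using S(2) by (intro vec.span_minimal) (auto simp: T_def)
    ultimately show ?thesis by auto
  qed
  have T_strict: "T j \<subset> T (Suc j)" if j: "j < CARD('n)" for j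
  proof -
    have VV: "V j \<subset> V (Suc j)"
      unfolding V_def using full_flag_psubset[OF st] j len by simp
    then have "T j \<subseteq> T (Suc j)"
      by (auto simp: T_def)
    moreover have "T j \<noteq> T (Suc j)"
      using VV V_T[of j] V_T[of "Suc j"] j by auto
    ultimately show ?thesis by auto
  qed
  have finT: "finite (T j)" for j
    using fin by (simp add: T_def)
  have card_less: "card (T i) < card (T (Suc i))" if "Suc i < Suc (CARD('n))" for i
    using T_strict[of i] that psubset_card_mono[OF finT] by simp
  \<comment> \<open>Strict growth from the empty \<open>T 0\<close> gives at least \<open>j\<close>
    lines, and strict growth up to the \<open>n\<close> lines of the frame gives at most
    \<open>j\<close>.\<close>
  have card_T: "card (T j) = j" if j: "j \<le> CARD('n)" for j
    using strict_chain_gap[of "Suc (CARD('n))" "\<lambda>i. card (T i)" 0 j, OF card_less]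
      strict_chain_gap[of "Suc (CARD('n))" "\<lambda>i. card (T i)" j "CARD('n)", OF card_less] j
    by (simp add: T0 Tn card)
  have step: "\<exists>L. L \<in> \<L> \<and> L \<notin> T j \<and> T (Suc j) = insert L (T j)" if j: "j < CARD('n)" for j
  proof -
    have "card (T (Suc j) - T j) = 1"
      using card_T[of j] card_T[of "Suc j"] j T_strict[OF j] by (simp add: card_Diff_subset finT)
    then obtain L where L: "T (Suc j) - T j = {L}"
      by (auto simp: card_1_singleton_iff)
    moreover have "T (Suc j) \<subseteq> \<L>"
      by (auto simp: T_def)
    ultimately show ?thesis
      using T_strict[OF j] by (intro exI[of _ L]) blast
  qed
  have step_iff: "cyclic_step \<O> (V j) (V (Suc j)) \<longleftrightarrow> cyclic_step \<O> {0} L"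
    if "j < CARD('n)" "L \<in> \<L>" "L \<notin> T j" "T (Suc j) = insert L (T j)" for j L
  proof -
    have "T j \<subseteq> \<L>"
      by (auto simp: T_def)
    moreover have "V j = vec.span (\<Union>(T j))" "V (Suc j) = vec.span (\<Union>(insert L (T j)))"
      using V_T[of j] V_T[of "Suc j"] that(1,4) by auto
    ultimately show ?thesis
      using cyclic_step_frame[OF int _ that(2,3)] by metis
  qed
  have hit: "\<exists>j < CARD('n). L \<notin> T j \<and> T (Suc j) = insert L (T j)" if L: "L \<in> \<L>" for L
  proof -
    \<comment> \<open>The line enters at the least such index, which is positive because
      \<open>T 0\<close> is empty.\<close>
    define k where "k = (LEAST k. L \<in> T k)"
    have k: "L \<in> T k" "k \<le> CARD('n)"
      unfolding k_def using L Tn by (auto intro: LeastI Least_le)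
    then obtain j where j: "k = Suc j"
      using T0 by (cases k) auto
    then have "L \<notin> T j"
      using not_less_Least[of j "\<lambda>k. L \<in> T k"] by (simp add: k_def)
    then show ?thesis
      using step[of j] j k by (intro exI[of _ j]) auto
  qed
  have "cyclic_flag \<O> s \<longleftrightarrow> (\<forall>j < CARD('n). cyclic_step \<O> (V j) (V (Suc j)))"
    unfolding cyclic_flag_def V_def len(2)[symmetric] less_Suc_eq_le by simp
  also have "\<dots> \<longleftrightarrow> (\<forall>L\<in>\<L>. cyclic_step \<O> {0} L)"
    using step hit step_iff by metis
  finally show ?thesis .
qed

text \<open>Stated for all top cycles of the apartment, so that it covers fundamental cycles without
  an explicit description of them.\<close>

lemma integral_apartment_cycle_kernel:
  fixes \<L> :: "('k::field ^ 'n) set set"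
  assumes "2 \<le> CARD('n)" "integral_frame \<O> \<L>" "z \<in> reduced_cycles (CARD('n) - 2) (apartment \<L>)"
  shows "z \<in> reduced_cycles (CARD('n) - 2) tits_building"
    and "frag_extend (\<lambda>s. if cyclic_flag \<O> s then frag_of () else 0) z = 0"
proof -
  show z: "z \<in> reduced_cycles (CARD('n) - 2) tits_building"
    using assms(3) by (auto simp: reduced_cycles_def simplicial_chain_group_def apartment_def)
  have keys: "s \<in> apartment \<L> \<and> length s = CARD('n) - 1" if "s \<in> Poly_Mapping.keys z" for s
    using that assms(1,3) by (auto simp: reduced_cycles_def simplicial_chain_group_def)
  show "frag_extend (\<lambda>s. if cyclic_flag \<O> s then frag_of () else 0) z = 0"
  proof (cases "\<forall>L\<in>\<L>. cyclic_step \<O> {0} L")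
    case True
    then have "frag_extend (\<lambda>s. if cyclic_flag \<O> s then frag_of () else 0) z =
        frag_extend (\<lambda>s. frag_of ()) z"
      using cyclic_flag_apartment[OF assms(2)] keys by (intro frag_extend_eq) simp
    then show ?thesis
      using top_cycle_coefficient_sum[OF assms(1) z] by simp
  next
    case False
    then show ?thesis
      using cyclic_flag_apartment[OF assms(2)] keys by (intro frag_extend_eq_0) auto
  qed
qed

section \<open>A cycle with a single cyclic flag\<close>

definition perm_flag :: "nat \<Rightarrow> (nat set \<Rightarrow> 'v) \<Rightarrow> (nat \<Rightarrow> nat) \<Rightarrow> 'v list" where
  "perm_flag m F \<sigma> = map (\<lambda>j. F (\<sigma> ` {..<Suc j})) [0..<m - 1]"

text \<open>When \<open>F A\<close> is the span of the basis vectors indexed by \<open>A\<close>,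
  this is the usual fundamental cycle of the apartment, seen as the barycentric subdivision of the
  boundary of a simplex.\<close>

definition alternating_chain :: "nat \<Rightarrow> (nat set \<Rightarrow> 'v) \<Rightarrow> 'v list \<Rightarrow>\<^sub>0 int" where
  "alternating_chain m F =
     (\<Sum>\<sigma> | \<sigma> permutes {..<m}. frag_cmul (sign \<sigma>) (frag_of (perm_flag m F \<sigma>)))"

lemma finite_perms: "finite {\<sigma>. \<sigma> permutes {..<m :: nat}}"
  by (simp add: finite_permutations)

lemma frag_extend_alternating_chain:
  "frag_extend f (alternating_chain m F) =
     (\<Sum>\<sigma> | \<sigma> permutes {..<m}. frag_cmul (sign \<sigma>) (f (perm_flag m F \<sigma>)))"
  unfolding alternating_chain_def frag_extend_sum[OF finite_perms]
  by (simp add: frag_extend_cmul)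

text \<open>
  Deleting the \<open>k\<close>-th entry of the flag of \<open>\<sigma>\<close> gives the same face as for \<open>\<sigma>\<close> composed with the
  transposition of \<open>k\<close> and \<open>k + 1\<close>, so the faces cancel in pairs.
\<close>

lemma boundary_alternating_chain: "simplicial_boundary (alternating_chain m F) = 0"
proof -
  define face where "face k s = take k s @ drop (Suc k) s" for k and s :: "'a list"
  have face_swap: "face k (perm_flag m F (\<sigma> \<circ> Transposition.transpose k (Suc k))) = face k (perm_flag m F \<sigma>)" for k \<sigma>
  proof -
    \<comment> \<open>Both \<open>k\<close> and \<open>Suc k\<close> lie outside the initial segment
      if \<open>j < k\<close>, and both lie inside it if \<open>j > k\<close>.\<close>
    have "Transposition.transpose k (Suc k) ` {..<Suc j} = {..<Suc j}" if "j \<noteq> k" for j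
    proof (cases "j < k")
      case True
      then have "Transposition.transpose k (Suc k) ` {..<Suc j} = id ` {..<Suc j}"
        by (intro image_cong) (auto simp: Transposition.transpose_def)
      then show ?thesis by simp
    next
      case False
      then show ?thesis
        using that by (intro permutes_image permutes_swap_id) auto
    qed
    then have "F ((\<sigma> \<circ> Transposition.transpose k (Suc k)) ` {..<Suc j}) = F (\<sigma> ` {..<Suc j})" if "j \<noteq> k" for j
      using that by (metis image_comp)
    moreover have "j \<noteq> k" if "j \<in> set (take k [0..<m - 1]) \<union> set (drop (Suc k) [0..<m - 1])" for j
      using that by (auto simp: in_set_conv_nth)
    ultimately show ?thesis
      unfolding face_def perm_flag_def take_map drop_map
      by (intro arg_cong2[of _ _ _ _ "(@)"] map_cong refl) blast+
  qed
  have zero: "(\<Sum>\<sigma> | \<sigma> permutes {..<m}. frag_cmul (sign \<sigma>) (frag_of (face k (perm_flag m F \<sigma>)))) = 0"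
    (is "?S = 0") if k: "k < m - 1" for k
  proof (rule frag_eq_neg_self)
    let ?t = "Transposition.transpose k (Suc k)"
    have t: "?t permutes {..<m}"
      using k by (intro permutes_swap_id) auto
    have "?S = (\<Sum>\<sigma> | \<sigma> permutes {..<m}. frag_cmul (sign (\<sigma> \<circ> ?t)) (frag_of (face k (perm_flag m F (\<sigma> \<circ> ?t)))))"
      by (rule sum_permutations_compose_right[OF t])
    also have "\<dots> = (\<Sum>\<sigma> | \<sigma> permutes {..<m}. - frag_cmul (sign \<sigma>) (frag_of (face k (perm_flag m F \<sigma>))))"
    proof (rule sum.cong)
      fix \<sigma> assume "\<sigma> \<in> {\<sigma>. \<sigma> permutes {..<m}}"
      then have "permutation \<sigma>" "permutation ?t"
        using t permutation_permutes finite_lessThan by blast+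
      then have "sign (\<sigma> \<circ> ?t) = - sign \<sigma>"
        by (simp add: sign_compose sign_swap_id)
      then show "frag_cmul (sign (\<sigma> \<circ> ?t)) (frag_of (face k (perm_flag m F (\<sigma> \<circ> ?t)))) =
          - frag_cmul (sign \<sigma>) (frag_of (face k (perm_flag m F \<sigma>)))"
        by (simp add: face_swap)
    qed simp
    also have "\<dots> = - ?S"
      by (simp only: sum_negf)
    finally show "?S = - ?S" .
  qed
  have "simplicial_boundary (alternating_chain m F) = (\<Sum>\<sigma> | \<sigma> permutes {..<m}. \<Sum>k<m - 1.
      frag_cmul ((-1) ^ k) (frag_cmul (sign \<sigma>) (frag_of (face k (perm_flag m F \<sigma>)))))"
    unfolding simplicial_boundary_def frag_extend_alternating_chain
    by (simp add: frag_cmul_sum face_def perm_flag_def mult.commute)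
  also have "\<dots> = (\<Sum>k<m - 1. frag_cmul ((-1) ^ k)
      (\<Sum>\<sigma> | \<sigma> permutes {..<m}. frag_cmul (sign \<sigma>) (frag_of (face k (perm_flag m F \<sigma>)))))"
    by (subst sum.swap) (simp only: frag_cmul_sum)
  also have "\<dots> = 0"
    by (simp add: zero)
  finally show ?thesis .
qed

text \<open>The least moved point moves upwards, since all smaller values are taken by fixed points.
  The flag of the permutation thus leaves the standard flag by adjoining a vector with too large an
  index.\<close>

lemma first_moved_point:
  fixes \<sigma> :: "nat \<Rightarrow> nat"
  assumes "\<sigma> permutes {..<m}" "\<sigma> \<noteq> id"
  obtains i where "\<sigma> ` {..<i} = {..<i}" "i < \<sigma> i" "\<sigma> i < m"
proof -
  define i where "i = (LEAST i. \<sigma> i \<noteq> i)"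
  have "\<exists>i. \<sigma> i \<noteq> i"
    using assms(2) by (auto simp: fun_eq_iff)
  then have i: "\<sigma> i \<noteq> i" and less: "\<And>j. j < i \<Longrightarrow> \<sigma> j = j"
    unfolding i_def using LeastI_ex[of "\<lambda>i. \<sigma> i \<noteq> i"] not_less_Least by blast+
  have "\<sigma> ` {..<i} = id ` {..<i}"
    using less by (intro image_cong) auto
  moreover have "i < m"
    using i assms(1) by (metis lessThan_iff permutes_not_in)
  then have "\<sigma> i < m"
    using permutes_in_image[OF assms(1), of i] by simp
  moreover have "\<not> \<sigma> i < i"
    using less[of "\<sigma> i"] i permutes_inj[OF assms(1)] by (auto dest: injD)
  ultimately show thesis
    using that[of i] i by simp
qed

section \<open>The bidiagonal frame and its maximal flags\<close>

locale bidiagonal_frame = dedekind \<O> for \<O> :: "'k::field set" +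
  fixes a b :: 'k and e :: "nat \<Rightarrow> 'n::finite"
  assumes b: "b \<noteq> 0"
    and colon: "\<And>x. colon a b \<noteq> (*) x ` \<O>"
    and e: "bij_betw e {..<CARD('n)} UNIV"
    and n2: "2 \<le> CARD('n)"
begin

text \<open>The matrix with these columns is upper bidiagonal, with diagonal
  \<open>1, b, ..., b\<close> and \<open>a\<close> above it. The enumeration \<open>e\<close> orders
  the coordinates, as the index type carries no order.\<close>

definition v :: "nat \<Rightarrow> 'k ^ 'n" where
  "v j = (if j = 0 then axis (e 0) 1 else a *s axis (e (j - 1)) 1 + b *s axis (e j) 1)"

definition F :: "nat set \<Rightarrow> ('k ^ 'n) set" where
  "F A = vec.span (v ` A)"

text \<open>The \<open>i\<close>-dimensional member of the standard flag, described by vanishing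
  coordinates.\<close>

definition E :: "nat \<Rightarrow> ('k ^ 'n) set" where
  "E i = {x. \<forall>k. i \<le> k \<and> k < CARD('n) \<longrightarrow> x $ e k = 0}"

lemma e_eq_iff: "i < CARD('n) \<Longrightarrow> j < CARD('n) \<Longrightarrow> e i = e j \<longleftrightarrow> i = j"
  using e by (auto simp: bij_betw_def inj_on_def)

lemma e_surj: "\<exists>k < CARD('n). i = e k"
proof -
  have "i \<in> e ` {..<CARD('n)}"
    using e by (simp add: bij_betw_def)
  then show ?thesis by auto
qed

lemma vec_eq_iff_e: "x = (y :: 'c ^ 'n) \<longleftrightarrow> (\<forall>k < CARD('n). x $ e k = y $ e k)"
  unfolding vec_eq_iff using e_surj by metis

lemma v_nth:
  assumes "i < CARD('n)" "k < CARD('n)"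
  shows "v i $ e k = (if k = i then if i = 0 then 1 else b else if Suc k = i then a else 0)"
  using assms by (cases i) (auto simp: v_def axis_def e_eq_iff)

text \<open>The matrix is triangular with nonzero diagonal: a multiple of \<open>v i\<close> clears
  the coordinate \<open>e i\<close> and leaves the later ones at zero.\<close>

lemma F_lessThan: "i \<le> CARD('n) \<Longrightarrow> F {..<i} = E i"
proof (induction i)
  case 0
  show ?case
    by (auto simp: F_def E_def vec_eq_iff_e)
next
  case (Suc i)
  have "x \<in> E (Suc i) \<longleftrightarrow> (\<exists>c. x - c *s v i \<in> E i)" for x
  proof
    assume x: "x \<in> E (Suc i)"
    have "x - (x $ e i / v i $ e i) *s v i \<in> E i"
      unfolding E_def
    proof (intro CollectI allI impI)
      fix k assume k: "i \<le> k \<and> k < CARD('n)"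
      show "(x - (x $ e i / v i $ e i) *s v i) $ e k = 0"
        using x k Suc.prems b by (cases "k = i") (auto simp: v_nth E_def)
    qed
    then show "\<exists>c. x - c *s v i \<in> E i" ..
  next
    assume "\<exists>c. x - c *s v i \<in> E i"
    then show "x \<in> E (Suc i)"
      using Suc.prems by (auto simp: E_def v_nth)
  qed
  then show ?case
    using Suc by (auto simp: F_def lessThan_Suc vec.span_insert)
qed

lemma E_card: "E (CARD('n)) = UNIV"
  by (auto simp: E_def)

lemma v_independent: "inj_on v {..<CARD('n)}" "vec.independent (v ` {..<CARD('n)})"
proof -
  have span: "vec.span (v ` {..<CARD('n)}) = UNIV"
    using F_lessThan[of "CARD('n)"] E_card by (simp add: F_def)
  have "card (v ` {..<CARD('n)}) \<le> CARD('n)"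
    using card_image_le[of "{..<CARD('n)}" v] by simp
  then show ind: "vec.independent (v ` {..<CARD('n)})"
    using span vec_dim_card[where ?'a = 'k and ?'n = 'n]
    by (intro vec.card_le_dim_spanning[of _ UNIV]) auto
  have "card (v ` {..<CARD('n)}) = CARD('n)"
    using vec.dim_eq_card_independent[OF ind] vec.dim_span[of "v ` {..<CARD('n)}"] span
      vec_dim_card[where ?'a = 'k and ?'n = 'n] by simp
  then show "inj_on v {..<CARD('n)}"
    by (intro eq_card_imp_inj_on) auto
qed

lemma v_notin_F:
  assumes "A \<subseteq> {..<CARD('n)}" "k < CARD('n)" "k \<notin> A"
  shows "v k \<notin> F A"
proof
  assume "v k \<in> F A"
  moreover have "v ` A \<subseteq> v ` {..<CARD('n)} - {v k}"
    using assms v_independent(1) by (auto simp: inj_on_def)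
  then have "F A \<subseteq> vec.span (v ` {..<CARD('n)} - {v k})"
    unfolding F_def by (rule vec.span_mono)
  ultimately show False
    using v_independent(2) assms(2) by (auto simp: vec.dependent_def)
qed

lemma perm_flag_building:
  assumes "\<sigma> permutes {..<CARD('n)}"
  shows "perm_flag (CARD('n)) F \<sigma> \<in> tits_building"
proof -
  have \<sigma>: "\<sigma> i < CARD('n)" if "i < CARD('n)" for i
    using permutes_in_image[OF assms, of i] that by simp
  have inj: "\<sigma> i = \<sigma> j \<longleftrightarrow> i = j" for i j
    using permutes_inj[OF assms] by (auto dest: injD)
  have notin: "v (\<sigma> j) \<notin> F (\<sigma> ` {..<i})" if "i \<le> j" "j < CARD('n)" for i j
    using that \<sigma> by (intro v_notin_F) (auto simp: inj)
  have isin: "v (\<sigma> j) \<in> F (\<sigma> ` {..<i})" if "j < i" for i j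
    unfolding F_def using that by (intro vec.span_base) auto
  have "F (\<sigma> ` {..<Suc i}) \<subset> F (\<sigma> ` {..<Suc j})" if "i < j" "j < CARD('n) - 1" for i j
  proof -
    have "F (\<sigma> ` {..<Suc i}) \<subseteq> F (\<sigma> ` {..<Suc j})"
      unfolding F_def using that by (intro vec.span_mono image_mono) auto
    then show ?thesis
      using notin[of "Suc i" j] isin[OF lessI, of j] that by force
  qed
  moreover have "F (\<sigma> ` {..<Suc j}) \<noteq> {0}" "F (\<sigma> ` {..<Suc j}) \<noteq> UNIV" if "j < CARD('n) - 1" for j
  proof -
    have "v (\<sigma> 0) \<noteq> 0"
      using notin[of 0 0] by (auto simp: F_def)
    then show "F (\<sigma> ` {..<Suc j}) \<noteq> {0}"
      using isin[of 0 "Suc j"] by auto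
    show "F (\<sigma> ` {..<Suc j}) \<noteq> UNIV"
      using notin[of "Suc j" "CARD('n) - 1"] that by auto
  qed
  moreover have "vec.subspace (F A)" for A
    by (simp add: F_def)
  ultimately show ?thesis
    by (auto simp: tits_building_def perm_flag_def sorted_wrt_iff_nth_less)
qed

lemma full_flag_perm_flag:
  assumes "\<sigma> permutes {..<CARD('n)}" "j \<le> CARD('n)"
  shows "full_flag (perm_flag (CARD('n)) F \<sigma>) ! j = F (\<sigma> ` {..<j})"
proof -
  have "F (\<sigma> ` {..<CARD('n)}) = UNIV"
    using F_lessThan[of "CARD('n)"] E_card by (simp add: permutes_image[OF assms(1)])
  then show ?thesis
    using assms(2) n2
    by (cases j) (auto simp: full_flag_def perm_flag_def nth_append F_def nth_Cons' le_less)
qed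

lemma length_perm_flag: "length (perm_flag m G \<sigma>) = m - 1"
  by (simp add: perm_flag_def)

text \<open>The coordinate \<open>e j\<close> identifies each quotient with \<O>, and the lattice
  vector \<open>axis (e j) 1\<close> maps to 1.\<close>

lemma cyclic_flag_id: "cyclic_flag \<O> (perm_flag (CARD('n)) F id)"
  unfolding cyclic_flag_def length_perm_flag
proof (intro allI impI)
  fix j assume "j \<le> CARD('n) - 1"
  then have j: "j < CARD('n)"
    using n2 by simp
  have "cyclic_step \<O> (E j) (E (Suc j))"
    unfolding cyclic_step_def
  proof (intro bexI ballI)
    show "axis (e j) 1 \<in> E (Suc j) \<inter> lattice_of \<O>"
      using j zero_mem one_mem by (auto simp: E_def axis_def e_eq_iff lattice_of_def)
    fix x assume x: "x \<in> E (Suc j) \<inter> lattice_of \<O>"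
    show "x - x $ e j *s axis (e j) 1 \<in> E j"
      unfolding E_def
    proof (intro CollectI allI impI)
      fix k assume "j \<le> k \<and> k < CARD('n)"
      then show "(x - x $ e j *s axis (e j) 1) $ e k = 0"
        using x j by (cases "k = j") (auto simp: E_def axis_def e_eq_iff)
    qed
    show "x $ e j \<in> \<O>"
      using x by (simp add: lattice_of_def)
  qed
  then show "cyclic_step \<O> (full_flag (perm_flag (CARD('n)) F id) ! j)
      (full_flag (perm_flag (CARD('n)) F id) ! Suc j)"
    using j by (simp add: full_flag_perm_flag permutes_id F_lessThan)
qed

text \<open>At the first moved point \<open>i\<close> the flag passes from \<open>E i\<close> to the
  sum of \<open>E i\<close> and the line of \<open>v j\<close>, where \<open>j > i\<close>. A
  multiple \<open>d *s v j\<close> is congruent to a lattice point modulo \<open>E i\<close> iff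
  \<open>d\<close> lies in \<open>colon a b\<close>, so the quotient is isomorphic to this
  nonprincipal module.\<close>

lemma not_cyclic_flag:
  assumes \<sigma>: "\<sigma> permutes {..<CARD('n)}" "\<sigma> \<noteq> id"
  shows "\<not> cyclic_flag \<O> (perm_flag (CARD('n)) F \<sigma>)"
proof
  assume cyc: "cyclic_flag \<O> (perm_flag (CARD('n)) F \<sigma>)"
  obtain i where i: "\<sigma> ` {..<i} = {..<i}" "i < \<sigma> i" "\<sigma> i < CARD('n)"
    using first_moved_point[OF \<sigma>] .
  define j where "j = \<sigma> i"
  have j: "i < j" "j < CARD('n)"
    using i by (auto simp: j_def)
  have "i \<le> CARD('n) - 1" "i \<le> CARD('n)" "Suc i \<le> CARD('n)"
    using i by auto
  then have "cyclic_step \<O> (F (\<sigma> ` {..<i})) (F (\<sigma> ` {..<Suc i}))"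
    using cyc full_flag_perm_flag[OF \<sigma>(1)] unfolding cyclic_flag_def length_perm_flag by metis
  moreover have "F (\<sigma> ` {..<i}) = E i"
    using i F_lessThan[of i] by simp
  moreover have W: "x \<in> F (\<sigma> ` {..<Suc i}) \<longleftrightarrow> (\<exists>c. x - c *s v j \<in> E i)" for x
    using i F_lessThan[of i] by (simp add: F_def lessThan_Suc vec.span_insert j_def)
  ultimately obtain w c where w: "w \<in> lattice_of \<O>" "w - c *s v j \<in> E i"
    and wx: "\<And>x d. x \<in> lattice_of \<O> \<Longrightarrow> x - d *s v j \<in> E i \<Longrightarrow> \<exists>t\<in>\<O>. x - t *s w \<in> E i"
    unfolding cyclic_step_def by (metis Int_iff)
  \<comment> \<open>As \<open>j > i\<close>, both \<open>j - 1\<close> and \<open>j\<close> are at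
    least \<open>i\<close>, where the coordinates of vectors of \<open>E i\<close> vanish.\<close>
  have coords: "x $ e (j - 1) = d * a" "x $ e j = d * b" if "x - d *s v j \<in> E i" for x d
  proof -
    have "(x - d *s v j) $ e k = 0" if "i \<le> k" "k < CARD('n)" for k
      using \<open>x - d *s v j \<in> E i\<close> that unfolding E_def by blast
    from this[of "j - 1"] this[of j] have "(x - d *s v j) $ e (j - 1) = 0" "(x - d *s v j) $ e j = 0"
      using j by linarith+
    then show "x $ e (j - 1) = d * a" "x $ e j = d * b"
      using j by (auto simp: v_nth)
  qed
  \<comment> \<open>The coefficient \<open>c\<close> of the generator \<open>w\<close> along
    \<open>v j\<close> generates the colon ideal.\<close>
  have "colon a b = (*) c ` \<O>"
  proof (intro subset_antisym subsetI)
    fix d assume d: "d \<in> colon a b"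
    have "d *s v j \<in> lattice_of \<O>"
      unfolding lattice_of_def
    proof (intro CollectI allI)
      fix i' obtain k where "k < CARD('n)" "i' = e k"
        using e_surj by blast
      then show "(d *s v j) $ i' \<in> \<O>"
        using d j zero_mem by (auto simp: v_nth colon_def)
    qed
    moreover have "d *s v j - d *s v j \<in> E i"
      by (simp add: E_def)
    ultimately obtain t where t: "t \<in> \<O>" "d *s v j - t *s w \<in> E i"
      using wx by blast
    have "(d *s v j - t *s w) $ e j = 0"
      using t(2) j by (simp add: E_def)
    then have "d * b = t * (c * b)"
      using coords(2)[OF w(2)] j by (simp add: v_nth)
    then have "d = c * t"
      using b by (simp add: ac_simps)
    then show "d \<in> (*) c ` \<O>"
      using t(1) by blast
  next
    fix d assume "d \<in> (*) c ` \<O>"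
    then obtain t where t: "t \<in> \<O>" "d = c * t" by blast
    have "c * a \<in> \<O>" "c * b \<in> \<O>"
      using w(1) coords[OF w(2)] unfolding lattice_of_def by (metis mem_Collect_eq)+
    then have "t * (c * a) \<in> \<O>" "t * (c * b) \<in> \<O>"
      using t(1) mult_mem by auto
    then show "d \<in> colon a b"
      by (simp add: colon_def t(2) ac_simps)
  qed
  then show False
    using colon by blast
qed

lemma alternating_chain_cycle:
  "alternating_chain (CARD('n)) F \<in> reduced_cycles (CARD('n) - 2) tits_building"
proof -
  have "Poly_Mapping.keys (alternating_chain (CARD('n)) F) \<subseteq>
      {s \<in> tits_building. length s = Suc (CARD('n) - 2)}"
    unfolding alternating_chain_def
  proof (rule order.trans[OF keys_sum], rule UN_least)
    fix \<sigma> assume "\<sigma> \<in> {\<sigma>. \<sigma> permutes {..<CARD('n)}}"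
    then show "Poly_Mapping.keys (frag_cmul (sign \<sigma>) (frag_of (perm_flag (CARD('n)) F \<sigma>))) \<subseteq>
        {s \<in> tits_building. length s = Suc (CARD('n) - 2)}"
      using perm_flag_building[of \<sigma>] n2 by (auto simp: length_perm_flag)
  qed
  then show ?thesis
    by (simp add: reduced_cycles_def simplicial_chain_group_def boundary_alternating_chain)
qed

lemma alternating_chain_cyclic_count:
  "frag_extend (\<lambda>s. if cyclic_flag \<O> s then frag_of () else 0) (alternating_chain (CARD('n)) F) = frag_of ()"
proof -
  have "frag_extend (\<lambda>s. if cyclic_flag \<O> s then frag_of () else 0) (alternating_chain (CARD('n)) F) =
      (\<Sum>\<sigma> | \<sigma> permutes {..<CARD('n)}. if \<sigma> = id then frag_of () else 0)"
    unfolding frag_extend_alternating_chain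
    using cyclic_flag_id not_cyclic_flag by (intro sum.cong) (auto simp: sign_id)
  also have "\<dots> = frag_of ()"
    using finite_perms by (simp add: permutes_id)
  finally show ?thesis .
qed

end

theorem theoremB:
  fixes \<O> :: "'k::field set"
  assumes "dedekind_domain \<O>"
    and "fractions \<O> = UNIV"
    and "finite (carrier (class_group \<O>))"
    and "1 < card (carrier (class_group \<O>))"
    and "2 \<le> CARD('n::finite)"
  shows "generate steinberg (integral_apartment_classes \<O> :: (('k ^ 'n) set list \<Rightarrow>\<^sub>0 int) set set)
           \<noteq> carrier steinberg"
proof
  assume gen: "generate steinberg (integral_apartment_classes \<O> :: (('k ^ 'n) set list \<Rightarrow>\<^sub>0 int) set set)
           = carrier steinberg"
  interpret dedekind \<O>
    using assms(1) by unfold_locales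
  obtain a b where ab: "b \<noteq> 0" "\<And>x. colon a b \<noteq> (*) x ` \<O>"
    using exists_nonprincipal_colon[OF assms(2,4)] by metis
  obtain e :: "nat \<Rightarrow> 'n" where e: "bij_betw e {..<CARD('n)} UNIV"
    using ex_bij_betw_nat_finite[of "UNIV :: 'n set"] by (auto simp: lessThan_atLeast0)
  interpret bidiagonal_frame \<O> a b e
    using ab e assms(5) by unfold_locales
  let ?f = "\<lambda>s :: ('k ^ 'n) set list. if cyclic_flag \<O> s then frag_of () else 0"
  let ?Z = "reduced_cycles (CARD('n) - 2) (tits_building :: ('k ^ 'n) set list set)"
  \<comment> \<open>The integral apartment classes lie in the kernel of the cyclic-flag count, and
    so does the subgroup they generate.\<close>
  have "integral_apartment_classes \<O> \<subseteq> (\<lambda>c. {c}) ` {c \<in> ?Z. frag_extend ?f c = 0}"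
  proof
    fix A :: "(('k ^ 'n) set list \<Rightarrow>\<^sub>0 int) set"
    assume "A \<in> integral_apartment_classes \<O>"
    then obtain \<L> z where "integral_frame \<O> \<L>" "fundamental_cycle \<L> z" "A = {z}"
      by (auto simp: integral_apartment_classes_def apartment_classes_def
          tits_building_homology_class[OF assms(5)])
    then show "A \<in> (\<lambda>c. {c}) ` {c \<in> ?Z. frag_extend ?f c = 0}"
      using integral_apartment_cycle_kernel[OF assms(5), of \<O> \<L> z]
      by (auto simp: fundamental_cycle_def)
  qed
  then have "carrier steinberg \<subseteq> (\<lambda>c. {c}) ` {c \<in> ?Z. frag_extend ?f c = 0}"
    using generate_steinberg_kernel[OF assms(5)] gen by blast
  moreover have "{alternating_chain (CARD('n)) F} \<in> carrier steinberg"
    using alternating_chain_cycle by (auto simp: carrier_steinberg[OF assms(5)])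
  ultimately have "frag_extend ?f (alternating_chain (CARD('n)) F) = 0"
    by blast
  then show False
    using alternating_chain_cyclic_count by simp
qed

end
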